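(* Let $p$ be a prime and let $B$ be a $p$-torsion-free ring equipped with two $\delta$-structures $\delta_1$ and $\delta_2$ such that $\delta_1(a)\equiv\delta_2(a)\pmod p$ for all $a\in B$. Then, for every ideal $I\subset B$ containing $p$, the prismatic envelopes defined using $\delta_1$ and $\delta_2$ are canonically isomorphic: $$\Delta_{B,\delta_1}(I)\cong\Delta_{B,\delta_2}(I).$$ More precisely, for every $x\in B$ and every $r\ge0$, the subrings of $B[1/p]$ generated over $B$ by $$\left\{\delta_1^t\left(\tfrac xp\right):0\le t\le r\right\}\quad\text{and}\quad\left\{\delta_2^t\left(\tfrac xp\right):0\le t\le r\right\}$$ coincide.
   Context: A $\delta$-structure $\delta$ on a $p$-torsion-free ring $B$ corresponds to the Frobenius lift $\phi(x)=x^p+p\delta(x)$. Extend $\phi$ to $B[1/p]$ by localization and $\delta$ to $B[1/p]$ by $\delta(y)=(\phi(y)-y^p)/p$; $\delta^t$ denotes the $t$-fold iterate, with $\delta^0(y)=y$. For an ideal $I\subset B$ containing $p$ the prismatic envelope $\Delta_{B,\delta}(I)$ is the $p$-adic completion of the subring $\Delta^0_{B,\delta}(I)=B\left[\delta^i(x/p):x\in I,\ i\ge0\right]$ of $B[1/p]$. *)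

theory Defs
  imports "HOL-Computational_Algebra.Primes" "HOL-Algebra.QuotRing" "HOL-Algebra.Generated_Rings"
begin

text \<open>Throughout, \<open>B\<close> is a commutative ring in the sense of \<open>HOL-Algebra\<close>, and the number \<open>p\<close>,
  regarded as an element of a ring \<open>R\<close>, is \<open>[p] \<cdot>\<^bsub>R\<^esub> \<one>\<^bsub>R\<^esub>\<close>.\<close>

definition p_torsion_free :: "nat \<Rightarrow> ('a, 'm) ring_scheme \<Rightarrow> bool" where
  "p_torsion_free p B \<longleftrightarrow> (\<forall>b \<in> carrier B. [p] \<cdot>\<^bsub>B\<^esub> b = \<zero>\<^bsub>B\<^esub> \<longrightarrow> b = \<zero>\<^bsub>B\<^esub>)"

text \<open>In the sum rule, \<open>(p choose i) div p\<close> is an exact division for prime \<open>p\<close> and \<open>0 < i < p\<close>, so that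
  the sum over \<open>i\<close> equals \<open>((a + b)\<^sup>p - a\<^sup>p - b\<^sup>p) / p\<close>.\<close>

definition delta_structure :: "nat \<Rightarrow> ('a, 'm) ring_scheme \<Rightarrow> ('a \<Rightarrow> 'a) \<Rightarrow> bool" where
  "delta_structure p B \<delta> \<longleftrightarrow>
     \<delta> \<in> carrier B \<rightarrow> carrier B \<and>
     \<delta> \<zero>\<^bsub>B\<^esub> = \<zero>\<^bsub>B\<^esub> \<and> \<delta> \<one>\<^bsub>B\<^esub> = \<zero>\<^bsub>B\<^esub> \<and>
     (\<forall>a \<in> carrier B. \<forall>b \<in> carrier B.
        \<delta> (a \<oplus>\<^bsub>B\<^esub> b) = (\<delta> a \<oplus>\<^bsub>B\<^esub> \<delta> b) \<ominus>\<^bsub>B\<^esub>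
          (\<Oplus>\<^bsub>B\<^esub>i \<in> {1..<p}. [((p choose i) div p)] \<cdot>\<^bsub>B\<^esub> (a [^]\<^bsub>B\<^esub> i \<otimes>\<^bsub>B\<^esub> b [^]\<^bsub>B\<^esub> (p - i)))) \<and>
     (\<forall>a \<in> carrier B. \<forall>b \<in> carrier B.
        \<delta> (a \<otimes>\<^bsub>B\<^esub> b) = (a [^]\<^bsub>B\<^esub> p \<otimes>\<^bsub>B\<^esub> \<delta> b \<oplus>\<^bsub>B\<^esub> b [^]\<^bsub>B\<^esub> p \<otimes>\<^bsub>B\<^esub> \<delta> a) \<oplus>\<^bsub>B\<^esub>
          [p] \<cdot>\<^bsub>B\<^esub> (\<delta> a \<otimes>\<^bsub>B\<^esub> \<delta> b))"

definition frobenius_lift :: "nat \<Rightarrow> ('a, 'm) ring_scheme \<Rightarrow> ('a \<Rightarrow> 'a) \<Rightarrow> 'a \<Rightarrow> 'a" where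
  "frobenius_lift p B \<delta> x = x [^]\<^bsub>B\<^esub> p \<oplus>\<^bsub>B\<^esub> [p] \<cdot>\<^bsub>B\<^esub> \<delta> x"


subsection \<open>The localization \<open>B[1/p]\<close>\<close>

text \<open>The pair \<open>(a, m)\<close> stands for \<open>a / p\<^sup>m\<close>.\<close>

definition loc_rel :: "nat \<Rightarrow> ('a, 'm) ring_scheme \<Rightarrow> (('a \<times> nat) \<times> ('a \<times> nat)) set" where
  "loc_rel p B =
     {((a, m), (b, n)). a \<in> carrier B \<and> b \<in> carrier B \<and>
        (\<exists>k. [(p ^ (k + n))] \<cdot>\<^bsub>B\<^esub> a = [(p ^ (k + m))] \<cdot>\<^bsub>B\<^esub> b)}"

definition loc_frac :: "nat \<Rightarrow> ('a, 'm) ring_scheme \<Rightarrow> 'a \<Rightarrow> nat \<Rightarrow> ('a \<times> nat) set" where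
  "loc_frac p B a m = loc_rel p B `` {(a, m)}"

definition loc :: "nat \<Rightarrow> ('a, 'm) ring_scheme \<Rightarrow> ('a \<times> nat) set ring" where
  "loc p B =
     \<lparr>carrier = (carrier B \<times> UNIV) // loc_rel p B,
      mult = (\<lambda>X Y. \<Union>(a, m) \<in> X. \<Union>(b, n) \<in> Y. loc_frac p B (a \<otimes>\<^bsub>B\<^esub> b) (m + n)),
      one = loc_frac p B \<one>\<^bsub>B\<^esub> 0,
      zero = loc_frac p B \<zero>\<^bsub>B\<^esub> 0,
      add = (\<lambda>X Y. \<Union>(a, m) \<in> X. \<Union>(b, n) \<in> Y.
               loc_frac p B ([(p ^ n)] \<cdot>\<^bsub>B\<^esub> a \<oplus>\<^bsub>B\<^esub> [(p ^ m)] \<cdot>\<^bsub>B\<^esub> b) (m + n))\<rparr>"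

definition loc_frobenius ::
  "nat \<Rightarrow> ('a, 'm) ring_scheme \<Rightarrow> ('a \<Rightarrow> 'a) \<Rightarrow> ('a \<times> nat) set \<Rightarrow> ('a \<times> nat) set" where
  "loc_frobenius p B \<delta> X = (\<Union>(a, m) \<in> X. loc_frac p B (frobenius_lift p B \<delta> a) m)"

definition loc_delta ::
  "nat \<Rightarrow> ('a, 'm) ring_scheme \<Rightarrow> ('a \<Rightarrow> 'a) \<Rightarrow> ('a \<times> nat) set \<Rightarrow> ('a \<times> nat) set" where
  "loc_delta p B \<delta> y =
     loc_frac p B \<one>\<^bsub>B\<^esub> 1 \<otimes>\<^bsub>loc p B\<^esub> (loc_frobenius p B \<delta> y \<ominus>\<^bsub>loc p B\<^esub> y [^]\<^bsub>loc p B\<^esub> p)"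

text \<open>The subring of \<open>B[1/p]\<close> generated over (the image of) \<open>B\<close> by a set.\<close>

definition adjoin :: "nat \<Rightarrow> ('a, 'm) ring_scheme \<Rightarrow> ('a \<times> nat) set set \<Rightarrow> ('a \<times> nat) set set" where
  "adjoin p B Y = generate_ring (loc p B) ((\<lambda>b. loc_frac p B b 0) ` carrier B \<union> Y)"


subsection \<open>The \<open>p\<close>-adic completion\<close>

definition p_power_ideal :: "nat \<Rightarrow> ('a, 'm) ring_scheme \<Rightarrow> nat \<Rightarrow> 'a set" where
  "p_power_ideal p R n = PIdl\<^bsub>R\<^esub> ([(p ^ n)] \<cdot>\<^bsub>R\<^esub> \<one>\<^bsub>R\<^esub>)"

text \<open>The limit of the rings \<open>R / p\<^sup>n R\<close>. A coset of \<open>p\<^sup>n\<^sup>+\<^sup>1 R\<close> is mapped to a coset of \<open>p\<^sup>n R\<close> by the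
  transition map if and only if it is contained in it.\<close>

definition p_completion :: "nat \<Rightarrow> ('a, 'm) ring_scheme \<Rightarrow> (nat \<Rightarrow> 'a set) ring" where
  "p_completion p R =
     \<lparr>carrier = {s. (\<forall>n. s n \<in> carrier (R Quot p_power_ideal p R n)) \<and> (\<forall>n. s (Suc n) \<subseteq> s n)},
      mult = (\<lambda>s t n. s n \<otimes>\<^bsub>R Quot p_power_ideal p R n\<^esub> t n),
      one = (\<lambda>n. \<one>\<^bsub>R Quot p_power_ideal p R n\<^esub>),
      zero = (\<lambda>n. \<zero>\<^bsub>R Quot p_power_ideal p R n\<^esub>),
      add = (\<lambda>s t n. s n \<oplus>\<^bsub>R Quot p_power_ideal p R n\<^esub> t n)\<rparr>"

definition to_p_completion :: "nat \<Rightarrow> ('a, 'm) ring_scheme \<Rightarrow> 'a \<Rightarrow> nat \<Rightarrow> 'a set" where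
  "to_p_completion p R y = (\<lambda>n. p_power_ideal p R n +>\<^bsub>R\<^esub> y)"


subsection \<open>Prismatic envelopes\<close>

definition envelope0 ::
  "nat \<Rightarrow> ('a, 'm) ring_scheme \<Rightarrow> ('a \<Rightarrow> 'a) \<Rightarrow> 'a set \<Rightarrow> ('a \<times> nat) set ring" where
  "envelope0 p B \<delta> I =
     (loc p B)\<lparr>carrier := adjoin p B {(loc_delta p B \<delta> ^^ i) (loc_frac p B x 1) |x i. x \<in> I}\<rparr>"

definition prismatic_envelope ::
  "nat \<Rightarrow> ('a, 'm) ring_scheme \<Rightarrow> ('a \<Rightarrow> 'a) \<Rightarrow> 'a set \<Rightarrow> (nat \<Rightarrow> ('a \<times> nat) set set) ring" where
  "prismatic_envelope p B \<delta> I = p_completion p (envelope0 p B \<delta> I)"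

end

theory Submission
  imports Defs
begin

text \<open>
  Write \<open>\<phi>\<^sub>i\<close> for the Frobenius lift of \<open>\<delta>\<^sub>i\<close> on \<open>B[1/p]\<close>, \<open>z = x/p\<close>, and \<open>A\<^sub>i(r)\<close> for the subring generated
  over \<open>B\<close> by \<open>\<delta>\<^sub>i\<^sup>t(z)\<close>, \<open>t \<le> r\<close>.  Let \<open>D = \<phi>\<^sub>1 - \<phi>\<^sub>2\<close>, so that \<open>\<delta>\<^sub>1(y) - \<delta>\<^sub>2(y) = D(y)/p\<close>.  By induction on \<open>r\<close>,
  \<open>A\<^sub>1(r) = A\<^sub>2(r)\<close>, and \<open>D\<close> maps this ring \<open>A(r)\<close> into \<open>p A(r)\<close>.

  The second half of the claim gives the next equality: \<open>\<delta>\<^sub>2\<^sup>r\<^sup>+\<^sup>1(z)\<close> is \<open>\<delta>\<^sub>2(w)\<close> for some \<open>w \<in> A(r)\<close>, and it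
  differs from \<open>\<delta>\<^sub>1(w) \<in> A\<^sub>1(r+1)\<close> by \<open>D(w)/p \<in> A(r)\<close>; the other inclusion is symmetric.

  To carry the second half to \<open>r + 1\<close>, let \<open>w = \<delta>\<^sub>1\<^sup>r(z)\<close>.  As \<open>p \<delta>\<^sub>1(w) = \<phi>\<^sub>1(w) - w\<^sup>p\<close>, it must be shown that
  \<open>D(\<phi>\<^sub>1(w) - w\<^sup>p) \<in> p\<^sup>2 A(r)\<close>.  The key object is the subring \<open>T(A)\<close> generated by \<open>B\<close>, the \<open>p\<close>-th powers of
  elements of \<open>A\<close>, and \<open>p A\<close>.  If \<open>D(A) \<subseteq> p A\<close>, then \<open>D(T(A)) \<subseteq> p\<^sup>2 A\<close> (lemma \<open>diff_pth\<close>): on \<open>B\<close> this is the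
  hypothesis \<open>\<delta>\<^sub>1 \<equiv> \<delta>\<^sub>2\<close> modulo \<open>p\<close>, and congruence modulo \<open>p\<close> implies congruence of \<open>p\<close>-th powers modulo
  \<open>p\<^sup>2\<close>.  It remains to see that \<open>\<phi>\<^sub>1(w) \<in> T(A(r))\<close> (lemma \<open>phi_iter_pth\<close>).  Indeed
  \<open>\<phi>\<^sub>1(w) = \<delta>\<^sub>1\<^sup>r(\<phi>\<^sub>1(z))\<close>, where \<open>\<phi>\<^sub>1(z) = p\<^sup>p\<^sup>-\<^sup>1 z\<^sup>p + \<delta>\<^sub>1(x)\<close> lies in \<open>T(A(0))\<close>, and \<open>\<delta>\<^sub>1\<close> maps \<open>T(A(s))\<close> into
  \<open>T(A(s+1))\<close> (lemma \<open>del_pth\<close>).  The same fact shows \<open>\<phi>\<^sub>i(A(r)) \<subseteq> A(r)\<close>, which is what makes divisibility of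
  \<open>D\<close> pass from generators to the subring they generate.

  Since only a ring with an inverse of \<open>p\<close> and two endomorphisms enter, this argument is carried out in an
  arbitrary commutative ring \<open>K\<close> in place of \<open>B[1/p]\<close>.  The equality of the rings \<open>\<Delta>\<^sup>0\<close> then follows by
  collecting all \<open>x \<in> I\<close> and all \<open>r\<close>, and the identity is the required isomorphism of completions.
\<close>

section \<open>Powers and binomials in commutative rings\<close>

lemma (in ring) subring_nat_pow: "subring A R \<Longrightarrow> u \<in> A \<Longrightarrow> u [^] (n::nat) \<in> A"
  by (induction n) (auto simp: subringE)

lemma (in ring) subring_add_pow: "subring A R \<Longrightarrow> u \<in> A \<Longrightarrow> [(n::nat)] \<cdot> u \<in> A"
  by (induction n) (auto simp: subringE)

lemma (in ring) subring_minus: "subring A R \<Longrightarrow> u \<in> A \<Longrightarrow> v \<in> A \<Longrightarrow> u \<ominus> v \<in> A"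
  by (simp add: a_minus_def subringE)

lemma (in ring) subring_finsum:
  assumes "subring A R" "\<And>i. i \<in> I \<Longrightarrow> f i \<in> A"
  shows "(\<Oplus>i\<in>I. f i) \<in> A"
  using assms(2)
proof (induction I rule: infinite_finite_induct)
  case (insert i I)
  then have "f \<in> I \<rightarrow> carrier R" "f i \<in> carrier R"
    using subringE(1)[OF assms(1)] by auto
  then show ?case using insert by (simp add: subringE[OF assms(1)])
qed (simp_all add: subringE[OF assms(1)])

context cring begin

lemma binomial_ring:
  assumes [simp]: "a \<in> carrier R" "b \<in> carrier R"
  shows "(a \<oplus> b) [^] n = (\<Oplus>i\<in>{..n}. [(n choose i)] \<cdot> (a [^] i \<otimes> b [^] (n - i)))"
proof (induction n)
  case 0
  show ?case by simp
next
  case (Suc n)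
  let ?t = "\<lambda>m c i. [(c::nat)] \<cdot> (a [^] (i::nat) \<otimes> b [^] (m - i :: nat))"
  let ?S = "\<Oplus>i\<in>{..n}. ?t n (n choose i) i"
  have a: "?S \<otimes> a = (\<Oplus>i\<in>{..n}. ?t (Suc n) (n choose i) (Suc i))"
    by (subst finsum_ldistr) (auto intro!: finsum_cong' simp: add_pow_ldistr add_pow_rdistr m_ac)
  have b1: "?S \<otimes> b = (\<Oplus>i\<in>{..n}. ?t (Suc n) (n choose i) i)"
    by (subst finsum_ldistr)
      (auto intro!: finsum_cong' simp: add_pow_ldistr m_assoc Suc_diff_le)
  have b2: "\<dots> = (\<Oplus>i\<in>{..Suc n}. ?t (Suc n) (n choose i) i)"
    by (subst finsum_Suc) (auto simp: binomial_eq_0)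
  have b3: "\<dots> = (\<Oplus>i\<in>{..n}. ?t (Suc n) (n choose Suc i) (Suc i)) \<oplus> ?t (Suc n) 1 0"
    by (subst finsum_Suc2) auto
  have "(a \<oplus> b) [^] Suc n = ?S \<otimes> a \<oplus> ?S \<otimes> b"
    using Suc by (simp add: r_distr)
  also have "\<dots> = ((\<Oplus>i\<in>{..n}. ?t (Suc n) (n choose i) (Suc i))
      \<oplus> (\<Oplus>i\<in>{..n}. ?t (Suc n) (n choose Suc i) (Suc i))) \<oplus> ?t (Suc n) 1 0"
    unfolding a b1 b2 b3 by (subst a_assoc) auto
  also have "\<dots> = (\<Oplus>i\<in>{..n}. ?t (Suc n) (Suc n choose Suc i) (Suc i)) \<oplus> ?t (Suc n) 1 0"
    by (subst finsum_addf[symmetric])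
      (auto intro!: arg_cong2[where f = "(\<oplus>)"] finsum_cong' simp: add.nat_pow_mult)
  also have "\<dots> = (\<Oplus>i\<in>{..Suc n}. ?t (Suc n) (Suc n choose i) i)"
    by (subst finsum_Suc2) auto
  finally show ?case .
qed

lemma binomial_prime:
  assumes [simp]: "a \<in> carrier R" "b \<in> carrier R" and p: "Factorial_Ring.prime (p::nat)"
  shows "(a \<oplus> b) [^] p = (a [^] p \<oplus> b [^] p) \<oplus>
    [p] \<cdot> (\<Oplus>i\<in>{1..<p}. [((p choose i) div p)] \<cdot> (a [^] i \<otimes> b [^] (p - i)))"
proof -
  let ?f = "\<lambda>i. [(p choose i)] \<cdot> (a [^] i \<otimes> b [^] (p - i))"
  have "p \<ge> 2" using p by (rule prime_ge_2_nat)
  then have set: "{..p} = insert p (insert 0 {1..<p})" by auto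
  have "(a \<oplus> b) [^] p = finsum R ?f (insert p (insert 0 {1..<p}))"
    using binomial_ring[of a b p] set by simp
  also have "\<dots> = a [^] p \<oplus> (b [^] p \<oplus> finsum R ?f {1..<p})"
    using \<open>p \<ge> 2\<close> by (subst finsum_insert, simp, simp, simp, simp, subst finsum_insert) auto
  also have "finsum R ?f {1..<p} =
      (\<Oplus>i\<in>{1..<p}. [p] \<cdot> ([((p choose i) div p)] \<cdot> (a [^] i \<otimes> b [^] (p - i))))"
    by (rule finsum_cong') (auto simp: add.nat_pow_pow dvd_choose_prime p)
  also have "\<dots> = [p] \<cdot> (\<Oplus>i\<in>{1..<p}. [((p choose i) div p)] \<cdot> (a [^] i \<otimes> b [^] (p - i)))"
    using finsum_rdistr[of "{1..<p}" "[p] \<cdot> \<one>" "\<lambda>i. [((p choose i) div p)] \<cdot> (a [^] i \<otimes> b [^] (p - i))"]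
    by (simp add: add_pow_ldistr)
  finally show ?thesis by (simp add: a_assoc)
qed

text \<open>The first two terms of the expansion in \<open>P\<close>.  For \<open>n = 0\<close> the truncated exponent \<open>n - 1\<close> is harmless,
  since the linear term has the coefficient \<open>n\<close>.\<close>

lemma pow_cong:
  assumes "subring A R" "P \<in> A" "u \<in> A" "e \<in> A"
  shows "\<exists>s\<in>A. (u \<oplus> P \<otimes> e) [^] (n::nat) = (u [^] n \<oplus> P \<otimes> ([n] \<cdot> (u [^] (n - 1) \<otimes> e))) \<oplus> P \<otimes> (P \<otimes> s)"
proof (induction n)
  case 0
  show ?case using subringE(1,2)[OF assms(1)] assms by (intro bexI[of _ \<zero>]) auto
next
  case (Suc n)
  then obtain s where s: "s \<in> A" and
    eq: "(u \<oplus> P \<otimes> e) [^] n = (u [^] n \<oplus> P \<otimes> ([n] \<cdot> (u [^] (n - 1) \<otimes> e))) \<oplus> P \<otimes> (P \<otimes> s)" by auto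
  have car: "u \<in> carrier R" "P \<in> carrier R" "e \<in> carrier R" "s \<in> carrier R"
    using subringE(1)[OF assms(1)] assms s by auto
  define g where "g = [n] \<cdot> (u [^] (n - 1) \<otimes> e)"
  have g: "g \<in> A" "g \<in> carrier R"
    unfolding g_def using assms car
    by (auto intro!: subring_add_pow subring_nat_pow subringE(6))
  have gu: "g \<otimes> u = [n] \<cdot> (u [^] n \<otimes> e)"
    unfolding g_def using car by (cases n) (auto simp: add_pow_ldistr add_pow_rdistr r_distr m_ac)
  have "(u \<oplus> P \<otimes> e) [^] Suc n = ((u [^] n \<oplus> P \<otimes> g) \<oplus> P \<otimes> (P \<otimes> s)) \<otimes> (u \<oplus> P \<otimes> e)"
    using eq g_def by simp
  also have "\<dots> = (u [^] n \<otimes> u \<oplus> P \<otimes> (g \<otimes> u \<oplus> u [^] n \<otimes> e)) \<oplus> P \<otimes> (P \<otimes> ((g \<otimes> e \<oplus> s \<otimes> u) \<oplus> P \<otimes> (s \<otimes> e)))"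
  proof -
    have "v \<in> carrier R \<Longrightarrow> ((v \<oplus> P \<otimes> g) \<oplus> P \<otimes> (P \<otimes> s)) \<otimes> (u \<oplus> P \<otimes> e) =
     (v \<otimes> u \<oplus> P \<otimes> (g \<otimes> u \<oplus> v \<otimes> e)) \<oplus> P \<otimes> (P \<otimes> ((g \<otimes> e \<oplus> s \<otimes> u) \<oplus> P \<otimes> (s \<otimes> e)))" for v
      using car g(2) by algebra
    then show ?thesis using car by simp
  qed
  also have "g \<otimes> u \<oplus> u [^] n \<otimes> e = [Suc n] \<cdot> (u [^] (Suc n - 1) \<otimes> e)"
    using car gu by simp
  also have "u [^] n \<otimes> u = u [^] Suc n" by simp
  finally show ?case
    using assms g s
    by (intro bexI[of _ "(g \<otimes> e \<oplus> s \<otimes> u) \<oplus> P \<otimes> (s \<otimes> e)"]) (auto intro!: subringE(6,7))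
qed

text \<open>Elements of \<open>A\<close> that are congruent modulo \<open>p A\<close> have \<open>p\<close>-th powers that are congruent modulo \<open>p\<^sup>2 A\<close>;
  primality of \<open>p\<close> is not needed for this.\<close>

lemma pow_p_cong:
  assumes "subring A R" "u \<in> A" "e \<in> A"
  shows "\<exists>s\<in>A. (u \<oplus> ([p] \<cdot> \<one>) \<otimes> e) [^] (p::nat) = u [^] p \<oplus> ([p] \<cdot> \<one>) \<otimes> (([p] \<cdot> \<one>) \<otimes> s)"
proof -
  let ?P = "[p] \<cdot> \<one>"
  have P: "?P \<in> A" using assms by (auto intro!: subring_add_pow simp: subringE)
  obtain s where s: "s \<in> A" and eq: "(u \<oplus> ?P \<otimes> e) [^] p = (u [^] p \<oplus> ?P \<otimes> ([p] \<cdot> (u [^] (p - 1) \<otimes> e))) \<oplus> ?P \<otimes> (?P \<otimes> s)"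
    using pow_cong[OF assms(1) P assms(2,3), of p] by auto
  have car: "u \<in> carrier R" "e \<in> carrier R" "s \<in> carrier R"
    using subringE(1)[OF assms(1)] assms s by auto
  let ?t = "u [^] (p - 1) \<otimes> e"
  have t: "?t \<in> A" using assms by (intro subringE(6) subring_nat_pow) auto
  have "[p] \<cdot> ?t = ?P \<otimes> ?t" using car by (simp add: add_pow_ldistr)
  then have "(u \<oplus> ?P \<otimes> e) [^] p = u [^] p \<oplus> ?P \<otimes> (?P \<otimes> (?t \<oplus> s))"
    using car eq by (simp add: r_distr a_assoc)
  then show ?thesis using t s assms by (intro bexI[of _ "?t \<oplus> s"]) (auto intro: subringE(7))
qed

lemma pow_prime_add:
  assumes "subring A R" "u \<in> A" "v \<in> A" "Factorial_Ring.prime (p::nat)"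
  shows "\<exists>s\<in>A. (u \<oplus> v) [^] p = (u [^] p \<oplus> v [^] p) \<oplus> ([p] \<cdot> \<one>) \<otimes> s"
proof -
  have car: "u \<in> carrier R" "v \<in> carrier R"
    using subringE(1)[OF assms(1)] assms by auto
  let ?s = "\<Oplus>i\<in>{1..<p}. [((p choose i) div p)] \<cdot> (u [^] i \<otimes> v [^] (p - i))"
  have s: "?s \<in> A" using assms
    by (auto intro!: subring_finsum subring_add_pow subring_nat_pow subringE(6))
  then have "?s \<in> carrier R" using subringE(1)[OF assms(1)] by auto
  then have "[p] \<cdot> ?s = ([p] \<cdot> \<one>) \<otimes> ?s" by (simp add: add_pow_ldistr)
  with s show ?thesis using binomial_prime[OF car assms(4)] by auto
qed

end

section \<open>A Frobenius lift on a ring in which \<open>p\<close> is invertible\<close>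

text \<open>\<open>K\<close> stands for \<open>B[1/p]\<close>, with \<open>q = 1/p\<close>, and \<open>\<phi>\<close> is a ring endomorphism.  The subring \<open>B\<close> is
  stable under \<open>y \<mapsto> (\<phi>(y) - y\<^sup>p) / p\<close>, which says that \<open>\<phi>\<close> lifts the Frobenius of \<open>B/p\<close>.\<close>

locale inverted_frobenius = cring K for K (structure) +
  fixes p :: nat and q and \<phi> and B
  assumes prime: "Factorial_Ring.prime p"
    and q_closed [simp]: "q \<in> carrier K"
    and q_inverse: "q \<otimes> ([p] \<cdot> \<one>) = \<one>"
    and phi_hom: "\<phi> \<in> ring_hom K K"
    and subring_base: "subring B K"
    and delta_base': "b \<in> B \<Longrightarrow> q \<otimes> (\<phi> b \<ominus> b [^] p) \<in> B"
begin

abbreviation P where "P \<equiv> [p] \<cdot> \<one>"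

text \<open>The operation \<open>\<delta>\<close> of the Frobenius lift, on all of \<open>K\<close>.\<close>

definition del where "del y = q \<otimes> (\<phi> y \<ominus> y [^] p)"

lemma P_closed: "P \<in> carrier K" by simp

lemma P_subring: "subring A K \<Longrightarrow> P \<in> A"
  by (auto intro!: subring_add_pow simp: subringE)

lemma base_carrier: "b \<in> B \<Longrightarrow> b \<in> carrier K"
  using subringE(1)[OF subring_base] by auto

lemmas phi_simps = ring_hom_closed[OF phi_hom] ring_hom_mult[OF phi_hom] ring_hom_add[OF phi_hom]
  ring_hom_one[OF phi_hom]

declare phi_simps(1)[simp]

lemma phi_endo: "ring_hom_cring K K \<phi>"
  using phi_hom cring_axioms by (simp add: ring_hom_cring_def ring_hom_cring_axioms_def)

lemma phi_pow: "u \<in> carrier K \<Longrightarrow> \<phi> (u [^] (n::nat)) = \<phi> u [^] n"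
  by (rule ring_hom_cring.hom_pow[OF phi_endo])

lemma phi_minus: "u \<in> carrier K \<Longrightarrow> \<phi> (\<ominus> u) = \<ominus> \<phi> u"
  by (rule ring_hom_cring.hom_a_inv[OF phi_endo])

lemma phi_diff: "u \<in> carrier K \<Longrightarrow> v \<in> carrier K \<Longrightarrow> \<phi> (u \<ominus> v) = \<phi> u \<ominus> \<phi> v"
  by (simp add: a_minus_def phi_simps phi_minus)

lemma phi_P: "\<phi> P = P"
proof -
  have "\<phi> ([(n::nat)] \<cdot> \<one>) = [n] \<cdot> \<one>" for n
    by (induction n) (simp_all add: phi_simps ring_hom_cring.hom_zero[OF phi_endo])
  then show ?thesis .
qed

lemma q_cancel: "u \<in> carrier K \<Longrightarrow> q \<otimes> (P \<otimes> u) = u" "u \<in> carrier K \<Longrightarrow> P \<otimes> (q \<otimes> u) = u"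
  using q_inverse by (metis m_assoc l_one P_closed q_closed m_comm)+

lemma phi_q: "\<phi> q = q"
proof -
  have "\<phi> q \<otimes> P = \<one>" using q_inverse phi_simps(2)[of q P] phi_P phi_simps(4) by simp
  then have "q \<otimes> (P \<otimes> \<phi> q) = q" by (simp add: m_comm)
  then show ?thesis by (simp add: q_cancel)
qed

lemma del_closed [simp]: "y \<in> carrier K \<Longrightarrow> del y \<in> carrier K"
  by (simp add: del_def)

lemma del_base: "b \<in> B \<Longrightarrow> del b \<in> B"
  unfolding del_def by (rule delta_base')

lemma phi_eq: "y \<in> carrier K \<Longrightarrow> \<phi> y = y [^] p \<oplus> P \<otimes> del y"
proof -
  assume y: "y \<in> carrier K"
  have "y [^] p \<oplus> P \<otimes> del y = y [^] p \<oplus> (\<phi> y \<ominus> y [^] p)"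
    unfolding del_def using y by (simp add: q_cancel)
  also have "\<dots> = \<phi> y"
    using y phi_simps(1)[OF y] nat_pow_closed[OF y, of p] by algebra
  finally show ?thesis by simp
qed

lemma del_eqI:
  assumes "y \<in> carrier K" "d \<in> carrier K" "\<phi> y = y [^] p \<oplus> P \<otimes> d"
  shows "del y = d"
proof -
  have "\<phi> y \<ominus> y [^] p = P \<otimes> d"
    unfolding assms(3) using nat_pow_closed[OF assms(1), of p] assms(2) P_closed by algebra
  then show ?thesis by (simp add: del_def q_cancel assms)
qed

lemma phi_del: "y \<in> carrier K \<Longrightarrow> \<phi> (del y) = del (\<phi> y)"
  by (simp add: del_def phi_simps phi_diff phi_pow phi_q)

lemma phi_del_iter: "y \<in> carrier K \<Longrightarrow> \<phi> ((del ^^ t) y) = (del ^^ t) (\<phi> y) \<and> (del ^^ t) y \<in> carrier K"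
  by (induction t) (auto simp: phi_del)

lemma del_add:
  assumes "subring A K" "u \<in> A" "v \<in> A"
  shows "\<exists>s\<in>A. del (u \<oplus> v) = (del u \<oplus> del v) \<ominus> s"
proof -
  obtain s where s: "s \<in> A" "(u \<oplus> v) [^] p = (u [^] p \<oplus> v [^] p) \<oplus> P \<otimes> s"
    using pow_prime_add[OF assms prime] by auto
  have car: "u \<in> carrier K" "v \<in> carrier K" "s \<in> carrier K"
    using subringE(1)[OF assms(1)] assms s by auto
  have c2: "u [^] p \<in> carrier K" "v [^] p \<in> carrier K" "del u \<in> carrier K" "del v \<in> carrier K"
    using car by auto
  have "\<phi> (u \<oplus> v) = (u [^] p \<oplus> P \<otimes> del u) \<oplus> (v [^] p \<oplus> P \<otimes> del v)"
    using car by (simp add: phi_simps phi_eq[OF car(1)] phi_eq[OF car(2)])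
  also have "\<dots> = (u \<oplus> v) [^] p \<oplus> P \<otimes> ((del u \<oplus> del v) \<ominus> s)"
    unfolding s(2) using c2 car(3) P_closed by algebra
  finally have "del (u \<oplus> v) = (del u \<oplus> del v) \<ominus> s"
    using car c2 by (intro del_eqI) auto
  then show ?thesis using s(1) by auto
qed

lemma del_mult:
  assumes "u \<in> carrier K" "v \<in> carrier K"
  shows "del (u \<otimes> v) = (u [^] p \<otimes> del v \<oplus> v [^] p \<otimes> del u) \<oplus> P \<otimes> (del u \<otimes> del v)"
proof (rule del_eqI)
  have c2: "u [^] p \<in> carrier K" "v [^] p \<in> carrier K" "del u \<in> carrier K" "del v \<in> carrier K"
    using assms by auto
  have "\<phi> (u \<otimes> v) = (u [^] p \<oplus> P \<otimes> del u) \<otimes> (v [^] p \<oplus> P \<otimes> del v)"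
    using assms by (simp add: phi_simps phi_eq[OF assms(1)] phi_eq[OF assms(2)])
  also have "\<dots> = u [^] p \<otimes> v [^] p \<oplus> P \<otimes> ((u [^] p \<otimes> del v \<oplus> v [^] p \<otimes> del u) \<oplus> P \<otimes> (del u \<otimes> del v))"
    using c2 P_closed by algebra
  finally show "\<phi> (u \<otimes> v) = (u \<otimes> v) [^] p \<oplus> P \<otimes> ((u [^] p \<otimes> del v \<oplus> v [^] p \<otimes> del u) \<oplus> P \<otimes> (del u \<otimes> del v))"
    using assms by (simp add: nat_pow_distrib)
qed (use assms in auto)

text \<open>By the sum and product rules it suffices to check on generators that \<open>\<delta>\<close> maps a subring into a
  larger one.\<close>

lemma del_generate:
  assumes G: "G \<subseteq> carrier K" and D: "subring D K" "generate_ring K G \<subseteq> D" "B \<subseteq> D"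
    and del: "\<And>g. g \<in> G \<Longrightarrow> del g \<in> D"
    and y: "y \<in> generate_ring K G"
  shows "del y \<in> D"
proof -
  have D_mult: "del (u \<otimes> v) \<in> D" if "u \<in> D" "v \<in> D" "del u \<in> D" "del v \<in> D" for u v
  proof -
    have "u \<in> carrier K" "v \<in> carrier K" using that subringE(1)[OF D(1)] by auto
    then show ?thesis using that D(1) P_subring[OF D(1)]
      by (auto simp: del_mult intro!: subringE(6,7) subring_nat_pow)
  qed
  note car = generate_ring_in_carrier[OF G]
  show ?thesis using y
  proof induction
    case one
    show ?case using del_base[OF subringE(3)[OF subring_base]] D by auto
  next
    case (incl h)
    then show ?case by (rule del)
  next
    case (a_inv h)
    \<comment> \<open>The sign rule for \<open>\<delta>\<close> depends on the parity of \<open>p\<close>; the product \<open>- h = (-1) h\<close> avoids the distinction.\<close>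
    have "\<ominus> \<one> \<in> B" using subring_base by (simp add: subringE)
    then have "del (\<ominus> \<one> \<otimes> h) \<in> D"
      using a_inv D del_base by (intro D_mult) auto
    then show ?case using car[OF a_inv.hyps] by (simp add: l_minus)
  next
    case (eng_add u v)
    then have "u \<in> D" "v \<in> D" using D(2) by auto
    then obtain s where "s \<in> D" "del (u \<oplus> v) = (del u \<oplus> del v) \<ominus> s"
      using del_add[OF D(1)] by blast
    then show ?case using eng_add.IH D(1) by (auto intro!: subring_minus subringE(7))
  next
    case (eng_mult u v)
    then show ?case using D(2) by (intro D_mult) auto
  qed
qed

text \<open>The subring \<open>A(r)\<close> generated over \<open>B\<close> by the iterates \<open>\<delta>\<^sup>t(x/p)\<close> with \<open>t \<le> r\<close>.\<close>

definition del_subring where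
  "del_subring x r = generate_ring K (B \<union> {(del ^^ t) (q \<otimes> x) |t. t \<le> r})"

text \<open>The subring \<open>T(A)\<close> generated by \<open>B\<close>, the \<open>p\<close>-th powers of elements of \<open>A\<close>, and \<open>p A\<close>.\<close>

definition pth_subring where
  "pth_subring A = generate_ring K (B \<union> {a [^] p |a. a \<in> A} \<union> {P \<otimes> a |a. a \<in> A})"

lemma del_subring_gens: "x \<in> carrier K \<Longrightarrow> B \<union> {(del ^^ t) (q \<otimes> x) |t. t \<le> r} \<subseteq> carrier K"
  using base_carrier phi_del_iter by auto

lemma subring_del_subring: "x \<in> carrier K \<Longrightarrow> subring (del_subring x r) K"
  unfolding del_subring_def by (intro generate_ring_is_subring del_subring_gens)

lemma base_del_subring: "B \<subseteq> del_subring x r"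
  unfolding del_subring_def by (auto intro: generate_ring.incl)

lemma iter_in_del_subring: "t \<le> r \<Longrightarrow> (del ^^ t) (q \<otimes> x) \<in> del_subring x r"
  unfolding del_subring_def by (auto intro: generate_ring.incl)

lemma del_subring_least:
  assumes "x \<in> carrier K" "subring D K" "B \<subseteq> D" "\<And>t. t \<le> r \<Longrightarrow> (del ^^ t) (q \<otimes> x) \<in> D"
  shows "del_subring x r \<subseteq> D"
  unfolding del_subring_def
  by (rule generate_ring_min_subring1[OF del_subring_gens]) (use assms in auto)

lemma del_subring_mono:
  assumes "x \<in> carrier K" "r \<le> s" shows "del_subring x r \<subseteq> del_subring x s"
  by (rule del_subring_least) (use assms subring_del_subring base_del_subring iter_in_del_subring in auto)

lemma del_del_subring:
  assumes x: "x \<in> carrier K" and y: "y \<in> del_subring x r"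
  shows "del y \<in> del_subring x (Suc r)"
proof (rule del_generate[OF del_subring_gens[OF x]])
  show "y \<in> generate_ring K (B \<union> {(del ^^ t) (q \<otimes> x) |t. t \<le> r})"
    using y by (simp add: del_subring_def)
  show "generate_ring K (B \<union> {(del ^^ t) (q \<otimes> x) |t. t \<le> r}) \<subseteq> del_subring x (Suc r)"
    using del_subring_mono[OF x, of r "Suc r"] by (simp add: del_subring_def)
  fix g assume "g \<in> B \<union> {(del ^^ t) (q \<otimes> x) |t. t \<le> r}"
  then show "del g \<in> del_subring x (Suc r)"
  proof
    assume "g \<in> B" then show ?thesis using del_base base_del_subring by auto
  next
    assume "g \<in> {(del ^^ t) (q \<otimes> x) |t. t \<le> r}"
    then obtain t where "t \<le> r" "g = (del ^^ t) (q \<otimes> x)" by auto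
    then show ?thesis using iter_in_del_subring[of "Suc t" "Suc r" x] by simp
  qed
qed (use x subring_del_subring base_del_subring in auto)

lemma pth_gens:
  assumes "subring A K" shows "B \<union> {a [^] p |a. a \<in> A} \<union> {P \<otimes> a |a. a \<in> A} \<subseteq> carrier K"
  using base_carrier subringE(1)[OF assms] by auto

lemma subring_pth: "subring A K \<Longrightarrow> subring (pth_subring A) K"
  unfolding pth_subring_def by (intro generate_ring_is_subring pth_gens)

lemma pth_subring_incl:
  "b \<in> B \<Longrightarrow> b \<in> pth_subring A" "a \<in> A \<Longrightarrow> a [^] p \<in> pth_subring A"
  "a \<in> A \<Longrightarrow> P \<otimes> a \<in> pth_subring A"
  unfolding pth_subring_def by (rule generate_ring.incl; blast)+

lemma pth_subring_least:
  assumes "subring A K" "subring D K" "B \<subseteq> D" "\<And>a. a \<in> A \<Longrightarrow> a [^] p \<in> D" "\<And>a. a \<in> A \<Longrightarrow> P \<otimes> a \<in> D"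
  shows "pth_subring A \<subseteq> D"
  unfolding pth_subring_def
  by (rule generate_ring_min_subring1[OF pth_gens]) (use assms in auto)

lemma pth_subring_le: "subring A K \<Longrightarrow> B \<subseteq> A \<Longrightarrow> pth_subring A \<subseteq> A"
  by (rule pth_subring_least) (auto intro: subring_nat_pow subringE(6) P_subring)

lemma pth_subring_mono: "subring A K \<Longrightarrow> subring A' K \<Longrightarrow> A \<subseteq> A' \<Longrightarrow> pth_subring A \<subseteq> pth_subring A'"
  by (rule pth_subring_least) (auto intro: pth_subring_incl subring_pth)

text \<open>On generators: \<open>\<delta>(a\<^sup>p)\<close> lies in \<open>p A'\<close>, because \<open>\<phi>(a) \<equiv> a\<^sup>p\<close> modulo \<open>p\<close> implies
  \<open>\<phi>(a\<^sup>p) \<equiv> (a\<^sup>p)\<^sup>p\<close> modulo \<open>p\<^sup>2\<close>, and \<open>\<delta>(p a) = a\<^sup>p + p \<delta>(a) - p\<^sup>p\<^sup>-\<^sup>1 a\<^sup>p\<close>.\<close>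

lemma del_pth:
  assumes A: "subring A K" "subring A' K" "A \<subseteq> A'" and del: "\<And>a. a \<in> A \<Longrightarrow> del a \<in> A'"
    and y: "y \<in> pth_subring A"
  shows "del y \<in> pth_subring A'"
proof (rule del_generate[OF pth_gens[OF A(1)]])
  let ?T = "pth_subring A'"
  note T = subring_pth[OF A(2)]
  fix g assume "g \<in> B \<union> {a [^] p |a. a \<in> A} \<union> {P \<otimes> a |a. a \<in> A}"
  then consider "g \<in> B" | a where "a \<in> A" "g = a [^] p" | a where "a \<in> A" "g = P \<otimes> a" by blast
  then show "del g \<in> ?T"
  proof cases
    case 1
    then show ?thesis using del_base pth_subring_incl by auto
  next
    case 2
    have a: "a \<in> carrier K" using 2 subringE(1)[OF A(1)] by auto
    have pow: "a [^] p \<in> A'" using A 2 by (auto intro: subring_nat_pow)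
    obtain s where s: "s \<in> A'"
      "(a [^] p \<oplus> P \<otimes> del a) [^] p = (a [^] p) [^] p \<oplus> P \<otimes> (P \<otimes> s)"
      using pow_p_cong[OF A(2) pow del[OF 2(1)], of p] by auto
    then have sc: "s \<in> carrier K" using subringE(1)[OF A(2)] by auto
    have "del g = P \<otimes> s"
      unfolding 2(2) using a sc s(2) by (intro del_eqI) (auto simp: phi_pow phi_eq[OF a])
    then show ?thesis using s pth_subring_incl by auto
  next
    case 3
    have a: "a \<in> carrier K" using 3 subringE(1)[OF A(1)] by auto
    have Pp: "P [^] p = P \<otimes> P [^] (p - 1)"
      using prime_gt_0_nat[OF prime] nat_pow_Suc[of P "p - 1"] by (simp add: m_comm)
    define c where "c = P [^] (p - 1)"
    have c: "c \<in> carrier K" "c \<in> ?T" unfolding c_def by (auto intro!: subring_nat_pow P_subring T)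
    have ca: "a [^] p \<in> carrier K" "del a \<in> carrier K" using a by auto
    have "del g = (a [^] p \<oplus> P \<otimes> del a) \<ominus> c \<otimes> a [^] p"
      unfolding 3(2)
    proof (rule del_eqI)
      have "\<phi> (P \<otimes> a) = P \<otimes> (a [^] p \<oplus> P \<otimes> del a)"
        using a by (simp add: phi_simps phi_P phi_eq[OF a])
      also have "\<dots> = (P \<otimes> c) \<otimes> a [^] p \<oplus> P \<otimes> ((a [^] p \<oplus> P \<otimes> del a) \<ominus> c \<otimes> a [^] p)"
        using c(1) ca P_closed by algebra
      also have "(P \<otimes> c) \<otimes> a [^] p = (P \<otimes> a) [^] p"
        using a Pp by (simp add: nat_pow_distrib c_def)
      finally show "\<phi> (P \<otimes> a) = (P \<otimes> a) [^] p \<oplus> P \<otimes> ((a [^] p \<oplus> P \<otimes> del a) \<ominus> c \<otimes> a [^] p)" .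
    qed (use a c ca in auto)
    also have "\<dots> \<in> ?T"
      using 3 A del c
      by (intro subring_minus[OF T] subringE(7)[OF T] subringE(6)[OF T c(2)] pth_subring_incl(2,3)) auto
    finally show ?thesis .
  qed
qed (use y A pth_subring_mono in \<open>auto simp: pth_subring_def[symmetric] intro: subring_pth pth_subring_incl\<close>)

text \<open>\<open>\<phi>\<close> commutes with \<open>\<delta>\<close>, so \<open>\<phi>(\<delta>\<^sup>t(z)) = \<delta>\<^sup>t(\<phi>(z))\<close> for \<open>z = x/p\<close>, and
  \<open>\<phi>(z) = p\<^sup>p\<^sup>-\<^sup>1 z\<^sup>p + \<delta>(x)\<close>.\<close>

lemma phi_iter_pth:
  assumes x: "x \<in> B"
  shows "\<phi> ((del ^^ t) (q \<otimes> x)) \<in> pth_subring (del_subring x t)"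
proof -
  have xc: "x \<in> carrier K" using x by (rule base_carrier)
  note A = subring_del_subring[OF xc]
  let ?z = "q \<otimes> x" let ?T = "pth_subring (del_subring x 0)"
  have zc: "?z \<in> carrier K" using xc by simp
  have x_eq: "x = P \<otimes> ?z" using xc by (simp add: q_cancel)
  have "x [^] p = P \<otimes> (P [^] (p - 1) \<otimes> ?z [^] p)"
    using prime_gt_0_nat[OF prime] nat_pow_Suc[of P "p - 1"] zc
    by (subst x_eq) (simp add: nat_pow_distrib m_ac)
  then have "q \<otimes> x [^] p = P [^] (p - 1) \<otimes> ?z [^] p" using zc by (simp add: q_cancel)
  moreover have "\<phi> ?z = q \<otimes> x [^] p \<oplus> del x"
    using xc by (simp add: phi_simps phi_q phi_eq[OF xc] r_distr q_cancel)
  moreover have "P [^] (p - 1) \<otimes> ?z [^] p \<in> ?T"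
    using iter_in_del_subring[of 0 0 x] pth_subring_incl(2)[of ?z "del_subring x 0"]
    by (auto intro: subringE(6)[OF subring_pth[OF A] subring_nat_pow[OF subring_pth[OF A]
          P_subring[OF subring_pth[OF A]]]])
  ultimately have "\<phi> ?z \<in> ?T"
    using subring_pth[OF A] del_base[OF x] pth_subring_incl(1) by (auto intro: subringE(7))
  have "(del ^^ t) (\<phi> ?z) \<in> pth_subring (del_subring x t)"
  proof (induction t)
    case 0
    then show ?case using \<open>\<phi> ?z \<in> ?T\<close> by simp
  next
    case (Suc t)
    have "del ((del ^^ t) (\<phi> ?z)) \<in> pth_subring (del_subring x (Suc t))"
      by (rule del_pth[OF A A del_subring_mono[OF xc] del_del_subring[OF xc] Suc.IH]) simp_all
    then show ?case by simp
  qed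
  then show ?thesis using phi_del_iter[OF zc] by simp
qed

lemma phi_del_subring:
  assumes x: "x \<in> B" and y: "y \<in> del_subring x r"
  shows "\<phi> y \<in> del_subring x r"
proof -
  have xc: "x \<in> carrier K" using x by (rule base_carrier)
  note A = subring_del_subring[OF xc]
  note E = subringE[OF A]
  show ?thesis
    using y[unfolded del_subring_def]
  proof induction
    case (incl h)
    then show ?case
    proof
      assume h: "h \<in> B"
      then have "h [^] p \<oplus> P \<otimes> del h \<in> B"
        using del_base subring_base by (auto intro: subringE(6,7) subring_nat_pow P_subring)
      then show ?thesis using base_del_subring phi_eq base_carrier[OF h] by auto
    next
      assume "h \<in> {(del ^^ t) (q \<otimes> x) |t. t \<le> r}"
      then obtain t where t: "t \<le> r" "h = (del ^^ t) (q \<otimes> x)" by auto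
      then have "\<phi> h \<in> pth_subring (del_subring x t)" using phi_iter_pth[OF x] by simp
      also have "\<dots> \<subseteq> del_subring x t" by (intro pth_subring_le A base_del_subring)
      also have "\<dots> \<subseteq> del_subring x r" using xc t by (intro del_subring_mono)
      finally show ?thesis .
    qed
  qed (use E generate_ring_in_carrier[OF del_subring_gens[OF xc]] in \<open>auto simp: phi_simps phi_minus\<close>)
qed

end

section \<open>Two congruent Frobenius lifts\<close>

text \<open>The two operations \<open>\<delta>\<close> are congruent modulo \<open>p B\<close> on \<open>B\<close>.\<close>

locale congruent_frobenii =
  F1: inverted_frobenius K p q \<phi>\<^sub>1 B + F2: inverted_frobenius K p q \<phi>\<^sub>2 B
  for K (structure) and p :: nat and q \<phi>\<^sub>1 \<phi>\<^sub>2 B +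
  assumes delta_cong: "b \<in> B \<Longrightarrow> q \<otimes> (F1.del b \<ominus> F2.del b) \<in> B"
begin

text \<open>The difference \<open>D\<close> of the two lifts.\<close>

definition diff where "diff y = \<phi>\<^sub>1 y \<ominus> \<phi>\<^sub>2 y"

lemma diff_closed [simp]: "y \<in> carrier K \<Longrightarrow> diff y \<in> carrier K"
  by (simp add: diff_def)

lemma del_diff:
  assumes "y \<in> carrier K" shows "F1.del y \<ominus> F2.del y = q \<otimes> diff y"
proof -
  have "\<phi>\<^sub>1 y \<in> carrier K" "\<phi>\<^sub>2 y \<in> carrier K" "y [^] p \<in> carrier K" using assms by auto
  then show ?thesis unfolding F1.del_def F2.del_def diff_def using F1.q_closed by algebra
qed

lemma diff_add:
  assumes "u \<in> carrier K" "v \<in> carrier K"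
  shows "diff (u \<oplus> v) = diff u \<oplus> diff v"
proof -
  have "\<phi>\<^sub>1 u \<in> carrier K" "\<phi>\<^sub>2 u \<in> carrier K" "\<phi>\<^sub>1 v \<in> carrier K" "\<phi>\<^sub>2 v \<in> carrier K" using assms by auto
  then show ?thesis using assms unfolding diff_def F1.phi_simps(3)[OF assms] F2.phi_simps(3)[OF assms] by algebra
qed

lemma diff_uminus:
  assumes "u \<in> carrier K"
  shows "diff (\<ominus> u) = \<ominus> diff u"
proof -
  have "\<phi>\<^sub>1 u \<in> carrier K" "\<phi>\<^sub>2 u \<in> carrier K" using assms by auto
  then show ?thesis using assms unfolding diff_def F1.phi_minus[OF assms] F2.phi_minus[OF assms] by algebra
qed

lemma diff_mult:
  assumes "u \<in> carrier K" "v \<in> carrier K"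
  shows "diff (u \<otimes> v) = \<phi>\<^sub>1 u \<otimes> diff v \<oplus> diff u \<otimes> \<phi>\<^sub>2 v"
proof -
  have "\<phi>\<^sub>1 u \<in> carrier K" "\<phi>\<^sub>2 u \<in> carrier K" "\<phi>\<^sub>1 v \<in> carrier K" "\<phi>\<^sub>2 v \<in> carrier K" using assms by auto
  then show ?thesis using assms unfolding diff_def F1.phi_simps(2)[OF assms] F2.phi_simps(2)[OF assms] by algebra
qed

lemma diff_scale:
  assumes "u \<in> carrier K" "v \<in> carrier K" "\<phi>\<^sub>1 u = u" "\<phi>\<^sub>2 u = u"
  shows "diff (u \<otimes> v) = u \<otimes> diff v"
proof -
  have "\<phi>\<^sub>1 v \<in> carrier K" "\<phi>\<^sub>2 v \<in> carrier K" using assms by auto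
  then show ?thesis using assms(1) F1.phi_simps(2)[OF assms(1,2)] F2.phi_simps(2)[OF assms(1,2)] 
    unfolding diff_def assms(3,4) by simp algebra
qed

text \<open>\<open>D\<close> is a derivation twisted by \<open>\<phi>\<^sub>1\<close> and \<open>\<phi>\<^sub>2\<close>, so divisibility of its values passes from generators to the
  generated subring, provided that \<open>\<phi>\<^sub>1\<close> and \<open>\<phi>\<^sub>2\<close> map this subring into the target \<open>S\<close>.
  The factor \<open>k\<close> is \<open>1/p\<close> or \<open>1/p\<^sup>2\<close> in the applications.\<close>

lemma diff_generate:
  assumes G: "G \<subseteq> carrier K" and S: "subring S K" and k: "k \<in> carrier K"
    and phi: "\<And>y. y \<in> generate_ring K G \<Longrightarrow> \<phi>\<^sub>1 y \<in> S" "\<And>y. y \<in> generate_ring K G \<Longrightarrow> \<phi>\<^sub>2 y \<in> S"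
    and gen: "\<And>g. g \<in> G \<Longrightarrow> k \<otimes> diff g \<in> S"
    and y: "y \<in> generate_ring K G"
  shows "k \<otimes> diff y \<in> S"
proof -
  note car = F1.generate_ring_in_carrier[OF G]
  note E = subringE[OF S]
  show ?thesis using y
  proof induction
    case one
    have "diff \<one> = \<zero>" by (simp add: diff_def F1.phi_simps F2.phi_simps a_minus_def F1.r_neg)
    then show ?case using k E by simp
  next
    case (incl h)
    then show ?case by (rule gen)
  next
    case (a_inv h)
    then show ?case using k E car by (simp add: diff_uminus F1.r_minus)
  next
    case (eng_add u v)
    then show ?case using k E car by (simp add: diff_add F1.r_distr)
  next
    case (eng_mult u v)
    then have "u \<in> carrier K" "v \<in> carrier K" using car by auto
    then have "k \<otimes> diff (u \<otimes> v) = \<phi>\<^sub>1 u \<otimes> (k \<otimes> diff v) \<oplus> (k \<otimes> diff u) \<otimes> \<phi>\<^sub>2 v"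
      using k by (simp add: diff_mult F1.r_distr F1.m_ac)
    then show ?case using eng_mult phi by (auto intro!: E(6,7))
  qed
qed

lemma diff_base: "b \<in> B \<Longrightarrow> q \<otimes> (q \<otimes> diff b) \<in> B"
  using delta_cong[of b] del_diff[of b] F1.base_carrier[of b] by simp

text \<open>If \<open>D(A) \<subseteq> p A\<close>, then \<open>D(T(A)) \<subseteq> p\<^sup>2 A\<close>.\<close>

lemma diff_pth:
  assumes A: "subring A K" "B \<subseteq> A"
    and phi: "\<And>a. a \<in> A \<Longrightarrow> \<phi>\<^sub>1 a \<in> A" "\<And>a. a \<in> A \<Longrightarrow> \<phi>\<^sub>2 a \<in> A"
    and diff: "\<And>a. a \<in> A \<Longrightarrow> q \<otimes> diff a \<in> A"
    and y: "y \<in> F1.pth_subring A"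
  shows "q \<otimes> (q \<otimes> diff y) \<in> A"
proof -
  have le: "F1.pth_subring A \<subseteq> A" using F1.pth_subring_le[OF A] .
  have yc: "y \<in> carrier K" using y le subringE(1)[OF A(1)] by auto
  have "(q \<otimes> q) \<otimes> diff y \<in> A"
  proof (rule diff_generate[OF F1.pth_gens[OF A(1)] A(1)])
    fix g assume "g \<in> B \<union> {a [^] p |a. a \<in> A} \<union> {F1.P \<otimes> a |a. a \<in> A}"
    then consider "g \<in> B" | a where "a \<in> A" "g = a [^] p" | a where "a \<in> A" "g = F1.P \<otimes> a" by blast
    then show "(q \<otimes> q) \<otimes> diff g \<in> A"
    proof cases
      case 1
      then show ?thesis using diff_base[of g] A F1.base_carrier[of g] by (auto simp: F1.m_assoc)
    next
      case 2
      have a: "a \<in> carrier K" using 2 subringE(1)[OF A(1)] by auto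
      define e where "e = q \<otimes> diff a"
      have e: "e \<in> A" unfolding e_def using 2 by (intro diff)
      have ec: "e \<in> carrier K" unfolding e_def using a by simp
      have c: "\<phi>\<^sub>1 a \<in> carrier K" "\<phi>\<^sub>2 a \<in> carrier K" using a by auto
      obtain s where s: "s \<in> A" "(\<phi>\<^sub>2 a \<oplus> F1.P \<otimes> e) [^] p = \<phi>\<^sub>2 a [^] p \<oplus> F1.P \<otimes> (F1.P \<otimes> s)"
        using F1.pow_p_cong[OF A(1) phi(2)[OF 2(1)] e, of p] by auto
      have sc: "s \<in> carrier K" using s subringE(1)[OF A(1)] by auto
      have "F1.P \<otimes> e = diff a" unfolding e_def using a by (simp add: F1.q_cancel)
      moreover have "\<phi>\<^sub>2 a \<oplus> diff a = \<phi>\<^sub>1 a" unfolding diff_def using c by algebra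
      ultimately have "\<phi>\<^sub>1 a [^] p = \<phi>\<^sub>2 a [^] p \<oplus> F1.P \<otimes> (F1.P \<otimes> s)"
        using s(2) by simp
      moreover have "v \<in> carrier K \<Longrightarrow> w \<in> carrier K \<Longrightarrow> (v \<oplus> w) \<ominus> v = w" for v w by algebra
      ultimately have "diff (a [^] p) = F1.P \<otimes> (F1.P \<otimes> s)"
        using a c sc by (simp add: diff_def F1.phi_pow F2.phi_pow)
      then have "(q \<otimes> q) \<otimes> diff g = s" using sc 2 by (simp add: F1.m_assoc F1.q_cancel)
      then show ?thesis using s by simp
    next
      case 3
      have a: "a \<in> carrier K" using 3 subringE(1)[OF A(1)] by auto
      have "diff g = F1.P \<otimes> diff a" unfolding 3(2) using a F1.phi_P F2.phi_P by (intro diff_scale) auto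
      then have "(q \<otimes> q) \<otimes> diff g = q \<otimes> diff a" using a by (simp add: F1.m_assoc F1.q_cancel)
      then show ?thesis using diff 3 by simp
    qed
  qed (use y le phi in \<open>auto simp: F1.pth_subring_def\<close>)
  then show ?thesis using yc by (simp add: F1.m_assoc)
qed

text \<open>The inductive step for the new generator: \<open>p \<delta>\<^sub>1(w) = \<phi>\<^sub>1(w) - w\<^sup>p\<close> lies in \<open>T(A)\<close>, so \<open>p D(\<delta>\<^sub>1(w))\<close> lies in
  \<open>p\<^sup>2 A\<close>.\<close>

lemma diff_del:
  assumes A: "subring A K" "B \<subseteq> A"
    and phi: "\<And>a. a \<in> A \<Longrightarrow> \<phi>\<^sub>1 a \<in> A" "\<And>a. a \<in> A \<Longrightarrow> \<phi>\<^sub>2 a \<in> A"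
    and diff: "\<And>a. a \<in> A \<Longrightarrow> q \<otimes> diff a \<in> A"
    and w: "w \<in> A" "\<phi>\<^sub>1 w \<in> F1.pth_subring A"
  shows "q \<otimes> diff (F1.del w) \<in> A"
proof -
  have wc: "w \<in> carrier K" using w subringE(1)[OF A(1)] by auto
  have "\<phi>\<^sub>1 w \<ominus> w [^] p \<in> F1.pth_subring A"
    using w A by (intro F1.subring_minus F1.subring_pth F1.pth_subring_incl(2))
  then have "q \<otimes> (q \<otimes> diff (\<phi>\<^sub>1 w \<ominus> w [^] p)) \<in> A"
    using diff_pth[OF A phi diff] by blast
  moreover have "diff (F1.del w) = q \<otimes> diff (\<phi>\<^sub>1 w \<ominus> w [^] p)"
    unfolding F1.del_def using wc F1.phi_q F2.phi_q by (intro diff_scale) auto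
  ultimately show ?thesis by simp
qed

text \<open>The two claims are proved together: divisibility of \<open>D\<close> at stage \<open>r\<close> gives equality at stage
  \<open>r + 1\<close>, which in turn makes the ring at stage \<open>r + 1\<close> stable under both lifts.\<close>

lemma del_subring_eq:
  assumes x: "x \<in> B"
  shows "F1.del_subring x r = F2.del_subring x r \<and> (\<forall>y\<in>F1.del_subring x r. q \<otimes> diff y \<in> F1.del_subring x r)"
proof -
  have xc: "x \<in> carrier K" using x by (rule F1.base_carrier)
  note A1 = F1.subring_del_subring[OF xc] and A2 = F2.subring_del_subring[OF xc]
  let ?z = "q \<otimes> x"
  have zc: "?z \<in> carrier K" using xc by simp
  have diffI: "\<forall>y\<in>F1.del_subring x r. q \<otimes> diff y \<in> F1.del_subring x r"
    if eq: "F1.del_subring x r = F2.del_subring x r"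
      and gens: "\<And>t. t \<le> r \<Longrightarrow> q \<otimes> diff ((F1.del ^^ t) ?z) \<in> F1.del_subring x r" for r
  proof
    fix y assume y: "y \<in> F1.del_subring x r"
    show "q \<otimes> diff y \<in> F1.del_subring x r"
    proof (rule diff_generate[OF F1.del_subring_gens[OF xc] A1])
      show "q \<in> carrier K" by simp
      show "y \<in> generate_ring K (B \<union> {(F1.del ^^ t) ?z |t. t \<le> r})"
        using y by (simp add: F1.del_subring_def)
    next
      fix u assume "u \<in> generate_ring K (B \<union> {(F1.del ^^ t) ?z |t. t \<le> r})"
      then have u: "u \<in> F1.del_subring x r" by (simp add: F1.del_subring_def)
      then show "\<phi>\<^sub>1 u \<in> F1.del_subring x r" by (rule F1.phi_del_subring[OF x])
      show "\<phi>\<^sub>2 u \<in> F1.del_subring x r" using F2.phi_del_subring[OF x, of u r] u eq by simp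
    next
      fix g assume "g \<in> B \<union> {(F1.del ^^ t) ?z |t. t \<le> r}"
      then show "q \<otimes> diff g \<in> F1.del_subring x r"
      proof
        assume g: "g \<in> B"
        then have gc: "g \<in> carrier K" by (rule F1.base_carrier)
        have "F1.P \<otimes> (q \<otimes> (q \<otimes> diff g)) \<in> B"
          using diff_base[OF g] F1.subring_base by (metis subringE(6) F1.P_subring)
        then have "q \<otimes> diff g \<in> B" using gc by (simp add: F1.q_cancel)
        then show ?thesis using F1.base_del_subring by auto
      qed (use gens in auto)
    qed
  qed
  show ?thesis
  proof (induction r)
    case 0
    have eq: "F1.del_subring x 0 = F2.del_subring x 0"
      by (simp add: F1.del_subring_def F2.del_subring_def)
    have "diff ?z = q \<otimes> diff x" using xc F1.phi_q F2.phi_q by (intro diff_scale) auto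
    then have "q \<otimes> diff ?z \<in> F1.del_subring x 0" using diff_base[OF x] F1.base_del_subring by auto
    then show ?case using eq diffI[of 0] by simp
  next
    case (Suc r)
    let ?A = "F1.del_subring x r"
    have eq: "F2.del_subring x r = ?A" and stable: "\<And>y. y \<in> ?A \<Longrightarrow> q \<otimes> diff y \<in> ?A"
      using Suc by auto
    note A = A1[of r]
    have le1: "?A \<subseteq> F1.del_subring x (Suc r)" using F1.del_subring_mono[OF xc] by simp
    have le2: "?A \<subseteq> F2.del_subring x (Suc r)" using F2.del_subring_mono[OF xc, of r "Suc r"] eq by simp
    have Ac: "y \<in> carrier K" if "y \<in> ?A" for y using that subringE(1)[OF A] by auto
    have del1: "F1.del y \<in> F2.del_subring x (Suc r)" if y: "y \<in> ?A" for y
    proof -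
      have d: "F1.del y \<in> carrier K" "F2.del y \<in> carrier K" using Ac[OF y] by auto
      then have "F1.del y = F2.del y \<oplus> (F1.del y \<ominus> F2.del y)" by algebra
      then have "F1.del y = F2.del y \<oplus> q \<otimes> diff y" using del_diff[OF Ac[OF y]] by simp
      then show ?thesis
        using F2.del_del_subring[OF xc, of y r] eq y stable[OF y] le2 subringE(7)[OF A2] by auto
    qed
    have del2: "F2.del y \<in> F1.del_subring x (Suc r)" if y: "y \<in> ?A" for y
    proof -
      have d: "F1.del y \<in> carrier K" "F2.del y \<in> carrier K" using Ac[OF y] by auto
      then have "F2.del y = F1.del y \<ominus> (F1.del y \<ominus> F2.del y)" by algebra
      then have "F2.del y = F1.del y \<ominus> q \<otimes> diff y" using del_diff[OF Ac[OF y]] by simp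
      then show ?thesis
        using F1.del_del_subring[OF xc y] stable[OF y] le1 F1.subring_minus[OF A1] by auto
    qed
    have eqS: "F1.del_subring x (Suc r) = F2.del_subring x (Suc r)"
    proof
      show "F1.del_subring x (Suc r) \<subseteq> F2.del_subring x (Suc r)"
      proof (rule F1.del_subring_least[OF xc A2 F2.base_del_subring])
        fix t assume "t \<le> Suc r"
        then consider "t \<le> r" | "t = Suc r" by linarith
        then show "(F1.del ^^ t) ?z \<in> F2.del_subring x (Suc r)"
        proof cases
          case 1 then show ?thesis using F1.iter_in_del_subring[of t r x] le2 by auto
        next
          case 2 then show ?thesis using F1.iter_in_del_subring[of r r x] del1 by auto
        qed
      qed
      show "F2.del_subring x (Suc r) \<subseteq> F1.del_subring x (Suc r)"
      proof (rule F2.del_subring_least[OF xc A1 F1.base_del_subring])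
        fix t assume "t \<le> Suc r"
        then consider "t \<le> r" | "t = Suc r" by linarith
        then show "(F2.del ^^ t) ?z \<in> F1.del_subring x (Suc r)"
        proof cases
          case 1 then show ?thesis using F2.iter_in_del_subring[of t r x] le1 eq by auto
        next
          case 2 then show ?thesis using F2.iter_in_del_subring[of r r x] del2 eq by auto
        qed
      qed
    qed
    have "q \<otimes> diff ((F1.del ^^ t) ?z) \<in> F1.del_subring x (Suc r)" if "t \<le> Suc r" for t
    proof (cases "t \<le> r")
      case True
      then show ?thesis using stable F1.iter_in_del_subring[of t r x] le1 by auto
    next
      case False
      then have t: "t = Suc r" using that by simp
      have "q \<otimes> diff (F1.del ((F1.del ^^ r) ?z)) \<in> ?A"
      proof (rule diff_del[OF A F1.base_del_subring])
        show "\<phi>\<^sub>1 a \<in> ?A" if "a \<in> ?A" for a using F1.phi_del_subring[OF x that] .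
        show "\<phi>\<^sub>2 a \<in> ?A" if "a \<in> ?A" for a using F2.phi_del_subring[OF x, of a r] that eq by simp
      qed (use stable F1.iter_in_del_subring F1.phi_iter_pth[OF x] in auto)
      then show ?thesis using t le1 by auto
    qed
    then show ?case using eqS diffI by blast
  qed
qed

end

section \<open>The localization \<open>B[1/p]\<close>\<close>

subsection \<open>Ring structure\<close>

text \<open>As \<open>B\<close> is \<open>p\<close>-torsion-free, the factor \<open>p\<^sup>k\<close> in the defining relation of \<open>B[1/p]\<close> can be cancelled, and
  \<open>B\<close> embeds into \<open>B[1/p]\<close>.\<close>

locale p_localization = cring B for B (structure) +
  fixes p :: nat
  assumes torsion_free: "p_torsion_free p B"
begin

abbreviation (input) frac where "frac \<equiv> loc_frac p B"
abbreviation (input) L where "L \<equiv> loc p B"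

text \<open>\<open>p\<^sup>k\<close> as an element of \<open>B\<close>, which turns multiples into products.\<close>

definition Q where "Q k = [(p ^ k :: nat)] \<cdot> \<one>"

lemma Q_closed [simp]: "Q k \<in> carrier B" by (simp add: Q_def)

lemma Q_eq: "a \<in> carrier B \<Longrightarrow> [(p ^ k :: nat)] \<cdot> a = Q k \<otimes> a"
  by (simp add: Q_def add_pow_ldistr)

lemma Q_add: "Q (k + l) = Q k \<otimes> Q l"
proof -
  have "Q k \<otimes> Q l = [(p ^ k :: nat)] \<cdot> ([(p ^ l :: nat)] \<cdot> \<one>)"
    unfolding Q_def by (subst add_pow_ldistr) auto
  also have "\<dots> = Q (k + l)"
    by (simp add: Q_def add.nat_pow_pow power_add mult.commute)
  finally show ?thesis by simp
qed

lemma Q_0 [simp]: "Q 0 = \<one>" by (simp add: Q_def)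

lemma Q_Suc_0: "Q (Suc 0) = [p] \<cdot> \<one>" by (simp add: Q_def)

lemma Q_eq_zero: "a \<in> carrier B \<Longrightarrow> Q k \<otimes> a = \<zero> \<Longrightarrow> a = \<zero>"
proof (induction k)
  case (Suc k)
  have c: "Q k \<otimes> a \<in> carrier B" using Suc.prems by simp
  have "Q (1 + k) \<otimes> a = Q 1 \<otimes> (Q k \<otimes> a)"
    unfolding Q_add by (rule m_assoc) (use Suc.prems in auto)
  then have "[p] \<cdot> (Q k \<otimes> a) = \<zero>"
    using Suc.prems(2) Q_eq[OF c, of 1] by simp
  then have "Q k \<otimes> a = \<zero>" using torsion_free c unfolding p_torsion_free_def by blast
  then show ?case using Suc.IH Suc.prems(1) by blast
qed simp

lemma Q_cancel: 
  assumes "a \<in> carrier B" "b \<in> carrier B" "Q k \<otimes> a = Q k \<otimes> b" shows "a = b"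
proof -
  have "Q k \<otimes> (a \<ominus> b) = \<zero>"
  proof -
    have "Q k \<otimes> (a \<ominus> b) = Q k \<otimes> a \<ominus> Q k \<otimes> b" using assms(1,2) Q_closed[of k] by algebra
    also have "\<dots> = \<zero>" unfolding assms(3) using assms(2) by (simp add: a_minus_def r_neg)
    finally show ?thesis .
  qed
  then have "a \<ominus> b = \<zero>" using assms(1,2) by (metis Q_eq_zero minus_closed)
  then show ?thesis using r_right_minus_eq[OF assms(1,2)] by blast
qed

lemma loc_rel_iff:
  "((a, m), (b, n)) \<in> loc_rel p B \<longleftrightarrow> a \<in> carrier B \<and> b \<in> carrier B \<and> Q n \<otimes> a = Q m \<otimes> b"
proof -
  have "(Q (k + n) \<otimes> a = Q (k + m) \<otimes> b) = (Q n \<otimes> a = Q m \<otimes> b)"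
    if "a \<in> carrier B" "b \<in> carrier B" for k
    using that Q_cancel[of "Q n \<otimes> a" "Q m \<otimes> b" k] by (auto simp: Q_add m_assoc)
  then show ?thesis by (auto simp: loc_rel_def Q_eq)
qed

lemma equiv_loc_rel: "equiv (carrier B \<times> UNIV) (loc_rel p B)"
proof (rule equivI)
  show "loc_rel p B \<subseteq> (carrier B \<times> UNIV) \<times> (carrier B \<times> UNIV)"
    by (auto simp: loc_rel_def)
  show "refl_on (carrier B \<times> UNIV) (loc_rel p B)"
    by (auto simp: refl_on_def loc_rel_iff)
  show "sym (loc_rel p B)"
    by (auto simp: sym_def loc_rel_iff)
  show "trans (loc_rel p B)"
  proof (rule transI)
    fix x y z assume xy: "(x, y) \<in> loc_rel p B" and yz: "(y, z) \<in> loc_rel p B"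
    obtain a m where x: "x = (a, m)" by (cases x)
    obtain b n where y: "y = (b, n)" by (cases y)
    obtain c l where z: "z = (c, l)" by (cases z)
    have a: "a \<in> carrier B" and b: "b \<in> carrier B" and c: "c \<in> carrier B"
      and e: "Q n \<otimes> a = Q m \<otimes> b" "Q l \<otimes> b = Q n \<otimes> c"
      using xy yz unfolding x y z loc_rel_iff by blast+
    have "Q n \<otimes> (Q l \<otimes> a) = Q l \<otimes> (Q n \<otimes> a)" using a by (simp add: m_lcomm)
    also have "\<dots> = Q m \<otimes> (Q l \<otimes> b)" unfolding e(1) using b by (simp add: m_lcomm)
    also have "\<dots> = Q n \<otimes> (Q m \<otimes> c)" unfolding e(2) using c by (simp add: m_lcomm)
    finally have "Q l \<otimes> a = Q m \<otimes> c" using Q_cancel[of "Q l \<otimes> a" "Q m \<otimes> c" n] a c by simp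
    then show "(x, z) \<in> loc_rel p B" using a c by (simp add: x z loc_rel_iff)
  qed
qed

lemma frac_eq_iff:
  "a \<in> carrier B \<Longrightarrow> b \<in> carrier B \<Longrightarrow> frac a m = frac b n \<longleftrightarrow> Q n \<otimes> a = Q m \<otimes> b"
  using eq_equiv_class_iff[OF equiv_loc_rel, of "(a, m)" "(b, n)"]
  by (simp add: loc_frac_def loc_rel_iff)

lemma mem_frac_iff:
  "a \<in> carrier B \<Longrightarrow> (b, n) \<in> frac a m \<longleftrightarrow> b \<in> carrier B \<and> Q n \<otimes> a = Q m \<otimes> b"
  by (simp add: loc_frac_def loc_rel_iff)

lemma self_mem_frac: "a \<in> carrier B \<Longrightarrow> (a, m) \<in> frac a m"
  by (simp add: mem_frac_iff)

lemma frac_in_L [simp]: "a \<in> carrier B \<Longrightarrow> frac a m \<in> carrier L"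
  by (auto simp: loc_def loc_frac_def intro: quotientI)

lemma L_cases:
  assumes "X \<in> carrier L" obtains a m where "a \<in> carrier B" "X = frac a m"
proof -
  have "X \<in> (carrier B \<times> UNIV) // loc_rel p B" using assms by (simp add: loc_def)
  then obtain x where "x \<in> carrier B \<times> UNIV" "X = loc_rel p B `` {x}" by (rule quotientE)
  then show ?thesis using that[of "fst x" "snd x"] by (simp add: loc_frac_def mem_Times_iff)
qed

text \<open>The ring operations of \<open>B[1/p]\<close> are unions over all representatives; they are computed from one
  representative once the term is seen not to depend on the choice.\<close>

lemma UN_const_pair:
  assumes "z0 \<in> X" "\<And>a m. (a, m) \<in> X \<Longrightarrow> f a m = c"
  shows "(\<Union>(a, m) \<in> X. f a m) = c"
proof -
  have "(case z of (a, m) \<Rightarrow> f a m) = c" if "z \<in> X" for z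
    using assms(2) that by (cases z) simp
  then show ?thesis using assms(1) by blast
qed

lemma L_mult:
  assumes ab: "a \<in> carrier B" "b \<in> carrier B"
  shows "frac a m \<otimes>\<^bsub>L\<^esub> frac b n = frac (a \<otimes> b) (m + n)"
proof -
  have "frac (a' \<otimes> b') (m' + n') = frac (a \<otimes> b) (m + n)"
    if "(a', m') \<in> frac a m" "(b', n') \<in> frac b n" for a' m' b' n'
  proof -
    have c: "a' \<in> carrier B" "b' \<in> carrier B" and e: "Q m' \<otimes> a = Q m \<otimes> a'" "Q n' \<otimes> b = Q n \<otimes> b'"
      using that ab by (auto simp: mem_frac_iff)
    have "Q (m + n) \<otimes> (a' \<otimes> b') = (Q m \<otimes> a') \<otimes> (Q n \<otimes> b')"
      using c by (simp add: Q_add m_ac)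
    also have "\<dots> = Q (m' + n') \<otimes> (a \<otimes> b)"
      unfolding e[symmetric] using ab by (simp add: Q_add m_ac)
    finally show ?thesis using ab c by (simp add: frac_eq_iff)
  qed
  note key = this
  show ?thesis
    unfolding loc_def monoid.simps
    by (rule UN_const_pair[OF self_mem_frac[OF ab(1)]],
      rule UN_const_pair[OF self_mem_frac[OF ab(2)]], rule key)
qed

lemma L_add:
  assumes ab: "a \<in> carrier B" "b \<in> carrier B"
  shows "frac a m \<oplus>\<^bsub>L\<^esub> frac b n = frac (Q n \<otimes> a \<oplus> Q m \<otimes> b) (m + n)"
proof -
  have "frac ([(p ^ n')] \<cdot> a' \<oplus> [(p ^ m')] \<cdot> b') (m' + n') = frac (Q n \<otimes> a \<oplus> Q m \<otimes> b) (m + n)"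
    if "(a', m') \<in> frac a m" "(b', n') \<in> frac b n" for a' m' b' n'
  proof -
    have c: "a' \<in> carrier B" "b' \<in> carrier B" and e: "Q m' \<otimes> a = Q m \<otimes> a'" "Q n' \<otimes> b = Q n \<otimes> b'"
      using that ab by (auto simp: mem_frac_iff)
    have "Q (m + n) \<otimes> (Q n' \<otimes> a' \<oplus> Q m' \<otimes> b') =
        (Q n \<otimes> Q n') \<otimes> (Q m \<otimes> a') \<oplus> (Q m \<otimes> Q m') \<otimes> (Q n \<otimes> b')"
      using c by (simp add: Q_add m_ac r_distr)
    also have "\<dots> = Q (m' + n') \<otimes> (Q n \<otimes> a \<oplus> Q m \<otimes> b)"
      unfolding e[symmetric] using ab by (simp add: Q_add m_ac r_distr)
    finally show ?thesis using ab c by (simp add: frac_eq_iff Q_eq)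
  qed
  note key = this
  show ?thesis
    unfolding loc_def ring.simps
    by (rule UN_const_pair[OF self_mem_frac[OF ab(1)]],
      rule UN_const_pair[OF self_mem_frac[OF ab(2)]], rule key)
qed

lemma L_one: "\<one>\<^bsub>L\<^esub> = frac \<one> 0" by (simp add: loc_def)
lemma L_zero: "\<zero>\<^bsub>L\<^esub> = frac \<zero> 0" by (simp add: loc_def)

lemma L_cring: "cring L"
proof (rule cringI)
  show "abelian_group L"
  proof (rule abelian_groupI)
    fix x y assume "x \<in> carrier L" "y \<in> carrier L"
    then show "x \<oplus>\<^bsub>L\<^esub> y \<in> carrier L" by (auto elim!: L_cases simp: L_add)
  next
    show "\<zero>\<^bsub>L\<^esub> \<in> carrier L" by (simp add: L_zero)
  next
    fix x y z assume "x \<in> carrier L" "y \<in> carrier L" "z \<in> carrier L"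
    obtain a m where a: "a \<in> carrier B" and x: "x = frac a m"
      using \<open>x \<in> carrier L\<close> by (rule L_cases)
    obtain b n where b: "b \<in> carrier B" and y: "y = frac b n"
      using \<open>y \<in> carrier L\<close> by (rule L_cases)
    obtain c l where c: "c \<in> carrier B" and z: "z = frac c l"
      using \<open>z \<in> carrier L\<close> by (rule L_cases)
    show "(x \<oplus>\<^bsub>L\<^esub> y) \<oplus>\<^bsub>L\<^esub> z = x \<oplus>\<^bsub>L\<^esub> (y \<oplus>\<^bsub>L\<^esub> z)"
      using a b c by (simp add: x y z L_add frac_eq_iff Q_add r_distr m_ac a_ac)
  next
    fix x y assume "x \<in> carrier L" "y \<in> carrier L"
    obtain a m where a: "a \<in> carrier B" and x: "x = frac a m"
      using \<open>x \<in> carrier L\<close> by (rule L_cases)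
    obtain b n where b: "b \<in> carrier B" and y: "y = frac b n"
      using \<open>y \<in> carrier L\<close> by (rule L_cases)
    show "x \<oplus>\<^bsub>L\<^esub> y = y \<oplus>\<^bsub>L\<^esub> x"
      using a b by (simp add: x y L_add frac_eq_iff Q_add r_distr m_ac a_ac)
  next
    fix x assume "x \<in> carrier L"
    then obtain a m where a: "a \<in> carrier B" and x: "x = frac a m" by (rule L_cases)
    show "\<zero>\<^bsub>L\<^esub> \<oplus>\<^bsub>L\<^esub> x = x" using a by (simp add: x L_zero L_add)
    have "frac (\<ominus> a) m \<oplus>\<^bsub>L\<^esub> x = \<zero>\<^bsub>L\<^esub>"
      using a by (simp add: x L_zero L_add frac_eq_iff r_minus l_neg)
    then show "\<exists>y\<in>carrier L. y \<oplus>\<^bsub>L\<^esub> x = \<zero>\<^bsub>L\<^esub>" using a by (intro bexI[of _ "frac (\<ominus> a) m"]) auto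
  qed
next
  show "comm_monoid L"
  proof (rule comm_monoidI)
    fix x y assume "x \<in> carrier L" "y \<in> carrier L"
    then show "x \<otimes>\<^bsub>L\<^esub> y \<in> carrier L" by (auto elim!: L_cases simp: L_mult)
  next
    show "\<one>\<^bsub>L\<^esub> \<in> carrier L" by (simp add: L_one)
  next
    fix x y z assume "x \<in> carrier L" "y \<in> carrier L" "z \<in> carrier L"
    obtain a m where a: "a \<in> carrier B" and x: "x = frac a m"
      using \<open>x \<in> carrier L\<close> by (rule L_cases)
    obtain b n where b: "b \<in> carrier B" and y: "y = frac b n"
      using \<open>y \<in> carrier L\<close> by (rule L_cases)
    obtain c l where c: "c \<in> carrier B" and z: "z = frac c l"
      using \<open>z \<in> carrier L\<close> by (rule L_cases)
    show "(x \<otimes>\<^bsub>L\<^esub> y) \<otimes>\<^bsub>L\<^esub> z = x \<otimes>\<^bsub>L\<^esub> (y \<otimes>\<^bsub>L\<^esub> z)"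
      using a b c by (simp add: x y z L_mult m_assoc add.assoc)
  next
    fix x assume "x \<in> carrier L"
    then show "\<one>\<^bsub>L\<^esub> \<otimes>\<^bsub>L\<^esub> x = x" by (auto elim!: L_cases simp: L_mult L_one)
  next
    fix x y assume "x \<in> carrier L" "y \<in> carrier L"
    then show "x \<otimes>\<^bsub>L\<^esub> y = y \<otimes>\<^bsub>L\<^esub> x" by (auto elim!: L_cases simp: L_mult m_comm add.commute)
  qed
next
  fix x y z assume "x \<in> carrier L" "y \<in> carrier L" "z \<in> carrier L"
  obtain a m where a: "a \<in> carrier B" and x: "x = frac a m"
    using \<open>x \<in> carrier L\<close> by (rule L_cases)
  obtain b n where b: "b \<in> carrier B" and y: "y = frac b n"
    using \<open>y \<in> carrier L\<close> by (rule L_cases)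
  obtain c l where c: "c \<in> carrier B" and z: "z = frac c l"
    using \<open>z \<in> carrier L\<close> by (rule L_cases)
  show "(x \<oplus>\<^bsub>L\<^esub> y) \<otimes>\<^bsub>L\<^esub> z = x \<otimes>\<^bsub>L\<^esub> z \<oplus>\<^bsub>L\<^esub> y \<otimes>\<^bsub>L\<^esub> z"
    using a b c by (simp add: x y z L_add L_mult frac_eq_iff Q_add r_distr l_distr m_ac)
qed

sublocale L: cring "loc p B" by (rule L_cring)

lemma L_uminus: "a \<in> carrier B \<Longrightarrow> \<ominus>\<^bsub>L\<^esub> frac a m = frac (\<ominus> a) m"
  by (rule L.minus_equality) (simp_all add: L_add L_zero frac_eq_iff r_minus l_neg)

lemma frac_add_same: "a \<in> carrier B \<Longrightarrow> b \<in> carrier B \<Longrightarrow> frac a m \<oplus>\<^bsub>L\<^esub> frac b m = frac (a \<oplus> b) m"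
  by (simp add: L_add frac_eq_iff Q_add r_distr l_distr m_ac)

lemma frac_diff_same: "a \<in> carrier B \<Longrightarrow> b \<in> carrier B \<Longrightarrow> frac a m \<ominus>\<^bsub>L\<^esub> frac b m = frac (a \<ominus> b) m"
  by (simp add: a_minus_def L_uminus frac_add_same)

lemma L_add_pow: "a \<in> carrier B \<Longrightarrow> [(n::nat)] \<cdot>\<^bsub>L\<^esub> frac a m = frac ([n] \<cdot> a) m"
  by (induction n) (auto simp: frac_add_same L_zero frac_eq_iff)

lemma L_pow: "a \<in> carrier B \<Longrightarrow> frac a m [^]\<^bsub>L\<^esub> (n::nat) = frac (a [^] n) (n * m)"
  by (induction n) (auto simp: L_mult L_one add.commute)

lemma inverse_p: "frac \<one> 1 \<otimes>\<^bsub>L\<^esub> ([p] \<cdot>\<^bsub>L\<^esub> \<one>\<^bsub>L\<^esub>) = \<one>\<^bsub>L\<^esub>"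
  by (simp add: L_one L_add_pow L_mult frac_eq_iff Q_Suc_0)

lemma inverse_p_mult: "a \<in> carrier B \<Longrightarrow> frac \<one> 1 \<otimes>\<^bsub>L\<^esub> frac ([p] \<cdot> a) 0 = frac a 0"
  using Q_eq[of a 1] by (simp add: L_mult frac_eq_iff)

text \<open>The image of \<open>B\<close> in \<open>B[1/p]\<close>.\<close>

abbreviation base where "base \<equiv> (\<lambda>b. loc_frac p B b 0) ` carrier B"

lemma subring_base: "subring base L"
proof (rule L.subringI)
  show "\<one>\<^bsub>L\<^esub> \<in> base" by (auto simp: L_one)
qed (auto simp: L_uminus L_mult frac_add_same)

lemma adjoin_least:
  assumes "Y \<subseteq> carrier L" "Z \<subseteq> carrier L" "Y \<subseteq> adjoin p B Z"
  shows "adjoin p B Y \<subseteq> adjoin p B Z"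
proof -
  have "base \<union> Z \<subseteq> carrier L" using assms by auto
  then show ?thesis
    unfolding adjoin_def using assms
    by (intro L.generate_ring_min_subring1 L.generate_ring_is_subring)
      (auto simp: adjoin_def intro: generate_ring.incl)
qed

end

subsection \<open>Delta structures on \<open>B\<close> and \<open>B[1/p]\<close>\<close>

locale p_localization_delta = p_localization B p for B (structure) and p +
  fixes \<delta>
  assumes prime: "Factorial_Ring.prime p" and delta: "delta_structure p B \<delta>"
begin

abbreviation \<phi> where "\<phi> \<equiv> frobenius_lift p B \<delta>"

lemma delta_closed [simp]: "a \<in> carrier B \<Longrightarrow> \<delta> a \<in> carrier B"
  using delta by (auto simp: delta_structure_def)

lemma lift_eq: "a \<in> carrier B \<Longrightarrow> \<phi> a = a [^] p \<oplus> Q 1 \<otimes> \<delta> a"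
  using Q_eq[of "\<delta> a" 1] by (simp add: frobenius_lift_def)

lemma lift_closed [simp]: "a \<in> carrier B \<Longrightarrow> \<phi> a \<in> carrier B"
  by (simp add: lift_eq)

lemma lift_one: "\<phi> \<one> = \<one>"
  using delta by (simp add: lift_eq delta_structure_def)

lemma lift_zero: "\<phi> \<zero> = \<zero>"
  using delta prime_gt_0_nat[OF prime] by (simp add: lift_eq delta_structure_def nat_pow_zero)

text \<open>Additivity and multiplicativity of \<open>\<phi>\<close> on \<open>B\<close> are the sum and product rules of the \<open>\<delta>\<close>-structure.\<close>

lemma lift_add:
  assumes ab: "a \<in> carrier B" "b \<in> carrier B" shows "\<phi> (a \<oplus> b) = \<phi> a \<oplus> \<phi> b"
proof -
  define s where "s = (\<Oplus>i\<in>{1..<p}. [((p choose i) div p)] \<cdot> (a [^] i \<otimes> b [^] (p - i)))"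
  have s: "s \<in> carrier B" unfolding s_def using ab by (intro finsum_closed) auto
  have pow: "(a \<oplus> b) [^] p = (a [^] p \<oplus> b [^] p) \<oplus> Q 1 \<otimes> s"
    using binomial_prime[OF ab prime] Q_eq[OF s, of 1] by (simp add: s_def)
  have d: "\<delta> (a \<oplus> b) = (\<delta> a \<oplus> \<delta> b) \<ominus> s"
    using delta ab by (auto simp: delta_structure_def s_def)
  have c: "a [^] p \<in> carrier B" "b [^] p \<in> carrier B" "\<delta> a \<in> carrier B" "\<delta> b \<in> carrier B" using ab by auto
  have "\<phi> (a \<oplus> b) = ((a [^] p \<oplus> b [^] p) \<oplus> Q 1 \<otimes> s) \<oplus> Q 1 \<otimes> ((\<delta> a \<oplus> \<delta> b) \<ominus> s)"
    using ab lift_eq[of "a \<oplus> b"] unfolding pow d by simp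
  also have "\<dots> = (a [^] p \<oplus> Q 1 \<otimes> \<delta> a) \<oplus> (b [^] p \<oplus> Q 1 \<otimes> \<delta> b)"
    using c s Q_closed[of 1] by algebra
  finally show ?thesis using ab by (simp add: lift_eq)
qed

lemma lift_mult:
  assumes ab: "a \<in> carrier B" "b \<in> carrier B" shows "\<phi> (a \<otimes> b) = \<phi> a \<otimes> \<phi> b"
proof -
  have c: "a [^] p \<in> carrier B" "b [^] p \<in> carrier B" "\<delta> a \<in> carrier B" "\<delta> b \<in> carrier B" using ab by auto
  have d: "\<delta> (a \<otimes> b) = (a [^] p \<otimes> \<delta> b \<oplus> b [^] p \<otimes> \<delta> a) \<oplus> Q 1 \<otimes> (\<delta> a \<otimes> \<delta> b)"
    using delta ab Q_eq[of "\<delta> a \<otimes> \<delta> b" 1] by (auto simp: delta_structure_def)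
  have "\<phi> (a \<otimes> b) = a [^] p \<otimes> b [^] p \<oplus> Q 1 \<otimes> ((a [^] p \<otimes> \<delta> b \<oplus> b [^] p \<otimes> \<delta> a) \<oplus> Q 1 \<otimes> (\<delta> a \<otimes> \<delta> b))"
    using ab lift_eq[of "a \<otimes> b"] unfolding d by (simp add: nat_pow_distrib)
  also have "\<dots> = (a [^] p \<oplus> Q 1 \<otimes> \<delta> a) \<otimes> (b [^] p \<oplus> Q 1 \<otimes> \<delta> b)"
    using c Q_closed[of 1] by algebra
  finally show ?thesis using ab by (simp add: lift_eq)
qed

lemma lift_Q: "\<phi> (Q k) = Q k"
proof -
  have "\<phi> ([(n::nat)] \<cdot> \<one>) = [n] \<cdot> \<one>" for n
    by (induction n) (simp_all add: lift_zero lift_one lift_add)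
  then show ?thesis by (simp add: Q_def)
qed

lemma loc_frobenius_frac:
  assumes a: "a \<in> carrier B" shows "loc_frobenius p B \<delta> (frac a m) = frac (\<phi> a) m"
proof -
  have "frac (\<phi> b) n = frac (\<phi> a) m" if "(b, n) \<in> frac a m" for b n
  proof -
    have b: "b \<in> carrier B" and "Q n \<otimes> a = Q m \<otimes> b" using that a by (auto simp: mem_frac_iff)
    then have "\<phi> (Q n \<otimes> a) = \<phi> (Q m \<otimes> b)" by simp
    then show ?thesis using a b by (simp add: lift_mult lift_Q frac_eq_iff)
  qed
  then show ?thesis unfolding loc_frobenius_def by (rule UN_const_pair[OF self_mem_frac[OF a]])
qed

lemma loc_frobenius_hom: "loc_frobenius p B \<delta> \<in> ring_hom L L"
proof (rule ring_hom_memI)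
  fix x y assume "x \<in> carrier L" "y \<in> carrier L"
  obtain a m where a: "a \<in> carrier B" and x: "x = frac a m"
    using \<open>x \<in> carrier L\<close> by (rule L_cases)
  obtain b n where b: "b \<in> carrier B" and y: "y = frac b n"
    using \<open>y \<in> carrier L\<close> by (rule L_cases)
  show "loc_frobenius p B \<delta> (x \<otimes>\<^bsub>L\<^esub> y) = loc_frobenius p B \<delta> x \<otimes>\<^bsub>L\<^esub> loc_frobenius p B \<delta> y"
    "loc_frobenius p B \<delta> (x \<oplus>\<^bsub>L\<^esub> y) = loc_frobenius p B \<delta> x \<oplus>\<^bsub>L\<^esub> loc_frobenius p B \<delta> y"
    using a b by (simp_all add: x y L_mult L_add loc_frobenius_frac lift_mult lift_add lift_Q)
qed (auto elim!: L_cases simp: loc_frobenius_frac L_one lift_one)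

lemma loc_delta_base: "b \<in> carrier B \<Longrightarrow> loc_delta p B \<delta> (frac b 0) = frac (\<delta> b) 0"
proof -
  assume b: "b \<in> carrier B"
  have c: "b [^] p \<in> carrier B" "[p] \<cdot> \<delta> b \<in> carrier B" using b by auto
  have "\<phi> b \<ominus> b [^] p = [p] \<cdot> \<delta> b" unfolding frobenius_lift_def using c by algebra
  then show ?thesis
    using b by (simp add: loc_delta_def loc_frobenius_frac L_pow frac_diff_same inverse_p_mult del: One_nat_def)
qed

sublocale F: inverted_frobenius "loc p B" p "loc_frac p B \<one> 1" "loc_frobenius p B \<delta>" base
proof (intro inverted_frobenius.intro L_cring inverted_frobenius_axioms.intro)
  fix b assume "b \<in> base"
  then show "frac \<one> 1 \<otimes>\<^bsub>L\<^esub> (loc_frobenius p B \<delta> b \<ominus>\<^bsub>L\<^esub> b [^]\<^bsub>L\<^esub> p) \<in> base"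
    using loc_delta_base by (auto simp: loc_delta_def)
qed (rule prime inverse_p loc_frobenius_hom subring_base frac_in_L one_closed)+

lemma F_del: "F.del = loc_delta p B \<delta>"
  unfolding F.del_def loc_delta_def by (rule refl)

lemma adjoin_eq_del_subring:
  assumes "x \<in> carrier B"
  shows "adjoin p B {(loc_delta p B \<delta> ^^ t) (frac x 1) |t. t \<le> r} = F.del_subring (frac x 0) r"
  using assms by (simp add: adjoin_def F.del_subring_def F_del L_mult del: One_nat_def)

lemma iter_closed: "x \<in> carrier B \<Longrightarrow> (loc_delta p B \<delta> ^^ t) (frac x m) \<in> carrier L"
  using F.phi_del_iter[of "frac x m" t, unfolded F_del] by simp

end

subsection \<open>Congruent delta structures\<close>

locale p_localization_congruent =
  D1: p_localization_delta B p \<delta>\<^sub>1 + D2: p_localization_delta B p \<delta>\<^sub>2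
  for B (structure) and p \<delta>\<^sub>1 \<delta>\<^sub>2 +
  assumes cong: "a \<in> carrier B \<Longrightarrow> \<delta>\<^sub>1 a \<ominus> \<delta>\<^sub>2 a \<in> PIdl ([p] \<cdot> \<one>)"
begin

sublocale C: congruent_frobenii "loc p B" p "loc_frac p B \<one> 1"
  "loc_frobenius p B \<delta>\<^sub>1" "loc_frobenius p B \<delta>\<^sub>2" D1.base
proof
  fix b assume "b \<in> D1.base"
  then obtain a where a: "a \<in> carrier B" "b = loc_frac p B a 0" by auto
  obtain c where c: "c \<in> carrier B" "\<delta>\<^sub>1 a \<ominus> \<delta>\<^sub>2 a = c \<otimes> ([p] \<cdot> \<one>)"
    using cong[OF a(1)] by (auto simp: cgenideal_def)
  then have "\<delta>\<^sub>1 a \<ominus> \<delta>\<^sub>2 a = [p] \<cdot> c" by (simp add: D1.add_pow_rdistr)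
  then have "loc_frac p B \<one> 1 \<otimes>\<^bsub>loc p B\<^esub> (D1.F.del b \<ominus>\<^bsub>loc p B\<^esub> D2.F.del b) = loc_frac p B c 0"
    using a c(1) D1.inverse_p_mult[OF c(1)]
    by (simp add: D1.F_del D2.F_del D1.loc_delta_base D2.loc_delta_base D1.frac_diff_same del: One_nat_def)
  then show "loc_frac p B \<one> 1 \<otimes>\<^bsub>loc p B\<^esub> (D1.F.del b \<ominus>\<^bsub>loc p B\<^esub> D2.F.del b) \<in> D1.base"
    using c(1) by simp
qed

lemma adjoin_iter_eq:
  assumes "x \<in> carrier B"
  shows "adjoin p B {(loc_delta p B \<delta>\<^sub>1 ^^ t) (loc_frac p B x 1) |t. t \<le> r} =
         adjoin p B {(loc_delta p B \<delta>\<^sub>2 ^^ t) (loc_frac p B x 1) |t. t \<le> r}"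
  using C.del_subring_eq[of "loc_frac p B x 0" r] assms
  by (simp add: D1.adjoin_eq_del_subring D2.adjoin_eq_del_subring del: One_nat_def)

text \<open>Each generator of the left-hand ring involves a single \<open>x\<close> and finitely many iterates, so
  \<open>adjoin_iter_eq\<close> applies to it.\<close>

lemma adjoin_all_subset:
  assumes "I \<subseteq> carrier B"
  shows "adjoin p B {(loc_delta p B \<delta>\<^sub>1 ^^ i) (loc_frac p B x 1) |x i. x \<in> I} \<subseteq>
         adjoin p B {(loc_delta p B \<delta>\<^sub>2 ^^ i) (loc_frac p B x 1) |x i. x \<in> I}"
proof (rule D1.adjoin_least)
  let ?Y2 = "{(loc_delta p B \<delta>\<^sub>2 ^^ i) (loc_frac p B x 1) |x i. x \<in> I}"
  show Y2: "?Y2 \<subseteq> carrier (loc p B)" using assms D2.iter_closed by auto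
  show "{(loc_delta p B \<delta>\<^sub>1 ^^ i) (loc_frac p B x 1) |x i. x \<in> I} \<subseteq> adjoin p B ?Y2"
  proof
    fix y assume "y \<in> {(loc_delta p B \<delta>\<^sub>1 ^^ i) (loc_frac p B x 1) |x i. x \<in> I}"
    then obtain x i where xi: "x \<in> I" "y = (loc_delta p B \<delta>\<^sub>1 ^^ i) (loc_frac p B x 1)" by auto
    then have "y \<in> adjoin p B {(loc_delta p B \<delta>\<^sub>1 ^^ t) (loc_frac p B x 1) |t. t \<le> i}"
      by (auto simp: adjoin_def intro!: generate_ring.incl)
    also have "\<dots> = adjoin p B {(loc_delta p B \<delta>\<^sub>2 ^^ t) (loc_frac p B x 1) |t. t \<le> i}"
      using xi assms by (intro adjoin_iter_eq) auto
    also have "\<dots> \<subseteq> adjoin p B ?Y2"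
      unfolding adjoin_def using xi Y2 by (intro D1.L.mono_generate_ring) auto
    finally show "y \<in> adjoin p B ?Y2" .
  qed
qed (use assms D1.iter_closed in auto)

end

lemma (in cring) PIdl_diff_commute:
  assumes "a \<in> carrier R" "b \<in> carrier R" "c \<in> carrier R" "a \<ominus> b \<in> PIdl c"
  shows "b \<ominus> a \<in> PIdl c"
proof -
  have "\<ominus> (a \<ominus> b) \<in> PIdl c"
    using additive_subgroup.a_inv_closed[OF ideal.axioms(1)[OF cgenideal_ideal[OF assms(3)]]] assms(4) .
  moreover have "\<ominus> (a \<ominus> b) = b \<ominus> a" using assms(1,2) by algebra
  ultimately show ?thesis by simp
qed

theorem theorem1p4:
  fixes B :: "('a, 'm) ring_scheme" and p :: nat and \<delta>\<^sub>1 \<delta>\<^sub>2 :: "'a \<Rightarrow> 'a"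
  assumes "cring B" and "Factorial_Ring.prime p" and "p_torsion_free p B"
    and "delta_structure p B \<delta>\<^sub>1" and "delta_structure p B \<delta>\<^sub>2"
    and "\<And>a. a \<in> carrier B \<Longrightarrow> \<delta>\<^sub>1 a \<ominus>\<^bsub>B\<^esub> \<delta>\<^sub>2 a \<in> PIdl\<^bsub>B\<^esub> ([p] \<cdot>\<^bsub>B\<^esub> \<one>\<^bsub>B\<^esub>)"
  shows "(\<forall>I. ideal I B \<and> [p] \<cdot>\<^bsub>B\<^esub> \<one>\<^bsub>B\<^esub> \<in> I \<longrightarrow>
            carrier (envelope0 p B \<delta>\<^sub>1 I) = carrier (envelope0 p B \<delta>\<^sub>2 I) \<and>
            (\<exists>f \<in> ring_iso (prismatic_envelope p B \<delta>\<^sub>1 I) (prismatic_envelope p B \<delta>\<^sub>2 I).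
               \<forall>y \<in> carrier (envelope0 p B \<delta>\<^sub>1 I).
                 f (to_p_completion p (envelope0 p B \<delta>\<^sub>1 I) y) =
                 to_p_completion p (envelope0 p B \<delta>\<^sub>2 I) y)) \<and>
         (\<forall>x \<in> carrier B. \<forall>r :: nat.
            adjoin p B {(loc_delta p B \<delta>\<^sub>1 ^^ t) (loc_frac p B x 1) |t. t \<le> r} =
            adjoin p B {(loc_delta p B \<delta>\<^sub>2 ^^ t) (loc_frac p B x 1) |t. t \<le> r})"
proof -
  interpret B: cring B by (rule assms(1))
  have delta_closed: "\<delta>\<^sub>1 a \<in> carrier B" "\<delta>\<^sub>2 a \<in> carrier B" if "a \<in> carrier B" for a
    using that assms(4,5) by (auto simp: delta_structure_def)
  interpret D12: p_localization_congruent B p \<delta>\<^sub>1 \<delta>\<^sub>2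
    by (intro p_localization_congruent.intro p_localization_delta.intro p_localization.intro
        p_localization_axioms.intro p_localization_delta_axioms.intro
        p_localization_congruent_axioms.intro assms)
  interpret D21: p_localization_congruent B p \<delta>\<^sub>2 \<delta>\<^sub>1
    by (intro p_localization_congruent.intro p_localization_delta.intro p_localization.intro
        p_localization_axioms.intro p_localization_delta_axioms.intro
        p_localization_congruent_axioms.intro assms(1-5) B.PIdl_diff_commute[OF _ _ _ assms(6)]
        delta_closed B.add.nat_pow_closed B.one_closed)
  have env: "envelope0 p B \<delta>\<^sub>1 I = envelope0 p B \<delta>\<^sub>2 I" if "ideal I B" for I
  proof -
    have "I \<subseteq> carrier B"
      using additive_subgroup.a_subset[OF ideal.axioms(1)[OF that]] .
    then have "adjoin p B {(loc_delta p B \<delta>\<^sub>1 ^^ i) (loc_frac p B x 1) |x i. x \<in> I} =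
        adjoin p B {(loc_delta p B \<delta>\<^sub>2 ^^ i) (loc_frac p B x 1) |x i. x \<in> I}"
      by (intro equalityI D12.adjoin_all_subset D21.adjoin_all_subset)
    then show ?thesis unfolding envelope0_def by (rule arg_cong)
  qed
  have id: "id \<in> ring_iso R R" for R :: "(nat \<Rightarrow> ('a \<times> nat) set set) ring"
    unfolding ring_iso_def by (simp add: ring_hom_memI)
  show ?thesis
  proof (intro conjI allI impI ballI)
    fix I assume "ideal I B \<and> [p] \<cdot>\<^bsub>B\<^esub> \<one>\<^bsub>B\<^esub> \<in> I"
    then have eq: "envelope0 p B \<delta>\<^sub>1 I = envelope0 p B \<delta>\<^sub>2 I" using env by blast
    show "carrier (envelope0 p B \<delta>\<^sub>1 I) = carrier (envelope0 p B \<delta>\<^sub>2 I)"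
      unfolding eq by (rule refl)
    show "\<exists>f \<in> ring_iso (prismatic_envelope p B \<delta>\<^sub>1 I) (prismatic_envelope p B \<delta>\<^sub>2 I).
        \<forall>y \<in> carrier (envelope0 p B \<delta>\<^sub>1 I).
          f (to_p_completion p (envelope0 p B \<delta>\<^sub>1 I) y) = to_p_completion p (envelope0 p B \<delta>\<^sub>2 I) y"
      unfolding prismatic_envelope_def eq by (intro bexI[OF _ id] ballI) simp
  next
    fix x and r :: nat assume "x \<in> carrier B"
    then show "adjoin p B {(loc_delta p B \<delta>\<^sub>1 ^^ t) (loc_frac p B x 1) |t. t \<le> r} =
        adjoin p B {(loc_delta p B \<delta>\<^sub>2 ^^ t) (loc_frac p B x 1) |t. t \<le> r}"
      by (rule D12.adjoin_iter_eq)
  qed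
qed

end
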